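(* Let $V$ be a finite-dimensional graded vector space over a field of characteristic $0$, and suppose $\{\ ,\ \}$ is a Pinczon bracket on the space $\mathcal C(V)$ of cyclic multilinear forms on $V[1]$. Then the space $\mathcal C_{vsp}(V)$ of cyclic, vanishing on shuffle products multilinear forms on $V[1]$ is a Lie subalgebra of $(\mathcal C(V),\{\ ,\ \})$.
   Context: Degrees and signs. $|x|$ is the degree of $x$ in $V$; $V[1]$ is $V$ with shifted degree $\deg(x)=|x|-1$; scalars have degree $0$. All formulas use Koszul's sign rule: in any relation between homogeneous objects, the first term has sign $+$ and every other term is implicitly multiplied by the sign of the permutation of the odd letters relating it to the first term. Cyclic forms and Pinczon brackets. A $(k+1)$-linear form $\Omega$ on $V[1]$ is cyclic if $\Omega(x_{k+1},x_1,\dots,x_k)=\Omega(x_1,\dots,x_{k+1})$; $\mathcal C^k$ is the space of $k$-linear cyclic forms, $\mathcal C(V)$ the space of all cyclic forms. $\Omega^{Cycl}$ is the sum of $\Omega$ over all cyclic permutations of its variables, $A\odot B=(A\otimes B)^{Cycl}$, $\iota_x\Omega=\Omega(x,\cdot,\dots,\cdot)$. A Pinczon bracket on $\mathcal C(V)$ is a bilinear map $\{\ ,\ \}$ such that: (1) $\{\mathcal C^{k+1},\mathcal C^{k'+1}\}\subset\mathcal C^{k+k'}$; (2) it makes $\mathcal C(V)$ a graded Lie algebra (for the grading $\deg-2$) with center $\mathcal C^0$; (3) for linear forms, $\{\alpha,(\beta_1\otimes\dots\otimes\beta_k)^{Cycl}\}=\sum_j\{\alpha,\beta_j\}(\beta_1\otimes\dots\hat{\beta_j}\dots\otimes\beta_k)^{Cycl}$.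 Pinczon brackets correspond bijectively to degree $0$, (graded) symmetric, non-degenerate bilinear forms $b$ on $V$ through $\{\Omega,\Omega'\}=\sum_i\iota_{e_i}\Omega\odot\iota_{e'_i}\Omega'$, where $(e_i),(e'_i)$ are bases with $b(e_i,e'_j)=\delta_{ij}$. Shuffles. $Sh(p,q)$ is the set of $\sigma\in\mathfrak S_{p+q}$ with $\sigma(1)<\dots<\sigma(p)$ and $\sigma(p+1)<\dots<\sigma(p+q)$; the $(p,q)$ shuffle product is $sh_{p,q}(x_1\otimes\dots\otimes x_p,\,x_{p+1}\otimes\dots\otimes x_{p+q})=\sum_{\sigma\in Sh(p,q)}x_{\sigma^{-1}(1)}\otimes\dots\otimes x_{\sigma^{-1}(p+q)}$ (Koszul signs in $V[1]$). A $k$-linear map on $V[1]$ vanishes on shuffle products if it vanishes on the image of $sh_{p,k-p}$ for all $0<p<k$. A $(k+1)$-linear cyclic form $\Omega$ vanishes on shuffle products if for every $y$ the map $(x_1,\dots,x_k)\mapsto\Omega(x_1,\dots,x_k,y)$ does.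
   Formalization: The condition "center C^0" contradicts the correspondence with forms b (for V = K in degree 0, C^3 is always central); it is read as: C^0 is central and no nonzero linear form is. That the bracket is given by the formula from some form b is made part of the definition of a Pinczon bracket. *)

theory Defs
  imports Complex_Main "HOL-Library.Function_Algebras" "HOL-Combinatorics.Permutations"
begin

section \<open>Graded spaces and graded Lie algebras\<close>

definition graded_space ::
  "('k::field \<Rightarrow> 'f::ab_group_add \<Rightarrow> 'f) \<Rightarrow> 'f set \<Rightarrow> (int \<Rightarrow> 'f set) \<Rightarrow> bool" where
  "graded_space s L G \<longleftrightarrow>
     module.subspace s L \<and>
     (\<forall>n. module.subspace s (G n) \<and> G n \<subseteq> L) \<and>
     (\<forall>x\<in>L. \<exists>!c. (\<forall>n. c n \<in> G n) \<and> finite {n. c n \<noteq> 0} \<and> x = (\<Sum>n | c n \<noteq> 0. c n))"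

definition graded_lie_algebra ::
  "('k::field \<Rightarrow> 'f::ab_group_add \<Rightarrow> 'f) \<Rightarrow> 'f set \<Rightarrow> (int \<Rightarrow> 'f set) \<Rightarrow> ('f \<Rightarrow> 'f \<Rightarrow> 'f) \<Rightarrow> bool" where
  "graded_lie_algebra s L G br \<longleftrightarrow>
     graded_space s L G \<and>
     (\<forall>x\<in>L. \<forall>y\<in>L. br x y \<in> L) \<and>
     (\<forall>x\<in>L. \<forall>y\<in>L. \<forall>z\<in>L. br (x + y) z = br x z + br y z \<and> br x (y + z) = br x y + br x z) \<and>
     (\<forall>c. \<forall>x\<in>L. \<forall>y\<in>L. br (s c x) y = s c (br x y) \<and> br x (s c y) = s c (br x y)) \<and>
     (\<forall>m n. \<forall>x\<in>G m. \<forall>y\<in>G n. br x y \<in> G (m + n) \<and> br x y = - s ((-1) powi (m * n)) (br y x)) \<and>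
     (\<forall>m n. \<forall>x\<in>G m. \<forall>y\<in>G n. \<forall>z\<in>L.
        br x (br y z) = br (br x y) z + s ((-1) powi (m * n)) (br y (br x z)))"

text \<open>A subalgebra of a graded Lie algebra is a graded subspace closed under the bracket.\<close>

definition graded_lie_subalgebra ::
  "('k::field \<Rightarrow> 'f::ab_group_add \<Rightarrow> 'f) \<Rightarrow> 'f set \<Rightarrow> (int \<Rightarrow> 'f set) \<Rightarrow> ('f \<Rightarrow> 'f \<Rightarrow> 'f) \<Rightarrow> 'f set \<Rightarrow> bool" where
  "graded_lie_subalgebra s L G br S \<longleftrightarrow>
     S \<subseteq> L \<and> graded_space s S (\<lambda>n. S \<inter> G n) \<and> (\<forall>x\<in>S. \<forall>y\<in>S. br x y \<in> S)"

section \<open>Permutations and Koszul signs\<close>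

definition cyclic_perms :: "nat \<Rightarrow> (nat \<Rightarrow> nat) set" where
  "cyclic_perms n = range (\<lambda>r i. if i < n then (i + r) mod n else i)"

text \<open>Positions are counted from 0, so the first block is \<open>{..<p}\<close> and the second \<open>{p..<p+q}\<close>.\<close>

definition Sh :: "nat \<Rightarrow> nat \<Rightarrow> (nat \<Rightarrow> nat) set" where
  "Sh p q = {\<sigma>. \<sigma> permutes {..<p + q} \<and> strict_mono_on {..<p} \<sigma> \<and> strict_mono_on {p..<p + q} \<sigma>}"

text \<open>Sign of the permutation of the odd letters when \<open>xs\<close>, with degrees \<open>ds\<close>, is rearranged to
  \<open>permute_list \<tau> xs\<close>.\<close>

definition koszul :: "int list \<Rightarrow> (nat \<Rightarrow> nat) \<Rightarrow> 'k::field" where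
  "koszul ds \<tau> =
     (-1) ^ card {(i, j). i < j \<and> j < length ds \<and> \<tau> j < \<tau> i \<and> odd (ds ! \<tau> i) \<and> odd (ds ! \<tau> j)}"

section \<open>Cyclic forms on the shifted space\<close>

text \<open>Multilinear forms of all arities are functions on lists: a \<open>k\<close>-linear form vanishes on lists of
  length different from \<open>k\<close>, so that a sum of forms of various arities is a pointwise sum.\<close>

type_synonym ('v, 'k) form = "'v list \<Rightarrow> 'k"

definition fscale :: "'k::field \<Rightarrow> ('v, 'k) form \<Rightarrow> ('v, 'k) form" where
  "fscale c \<Omega> = (\<lambda>xs. c * \<Omega> xs)"

definition \<iota> :: "'v \<Rightarrow> ('v, 'k) form \<Rightarrow> ('v, 'k) form" where
  "\<iota> x \<Omega> = (\<lambda>xs. \<Omega> (x # xs))"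

locale fd_graded_vector_space = vector_space scale
  for scale :: "'k::field_char_0 \<Rightarrow> 'v::ab_group_add \<Rightarrow> 'v" +
  fixes gr :: "int \<Rightarrow> 'v set"
  assumes graded: "graded_space scale UNIV gr"
    and finite_dimensional: "\<exists>B. finite B \<and> span B = UNIV"
begin

text \<open>The shifted space: \<open>x\<close> has degree \<open>d\<close> in \<open>V[1]\<close> iff it has degree \<open>d + 1\<close> in \<open>V\<close>.\<close>

definition V1 :: "int \<Rightarrow> 'v set" where
  "V1 d = gr (d + 1)"

definition V1_part :: "int \<Rightarrow> 'v \<Rightarrow> 'v" where
  "V1_part d x = (THE c. (\<forall>n. c n \<in> V1 n) \<and> finite {n. c n \<noteq> 0} \<and> x = (\<Sum>n | c n \<noteq> 0. c n)) d"

definition homogeneous :: "'v list \<Rightarrow> int list \<Rightarrow> bool" where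
  "homogeneous xs ds \<longleftrightarrow> list_all2 (\<lambda>x d. x \<in> V1 d) xs ds"

text \<open>A formula \<open>F ds xs\<close> involving Koszul signs only makes sense for homogeneous \<open>xs\<close> of degrees \<open>ds\<close>;
  this is its multilinear extension to all lists. The sum is finite because only finitely many
  \<open>V1 d\<close> are nonzero.\<close>

definition extend :: "(int list \<Rightarrow> 'v list \<Rightarrow> 'k) \<Rightarrow> ('v, 'k) form" where
  "extend F xs =
     (\<Sum>ds \<in> {ds. length ds = length xs \<and> set ds \<subseteq> {d. V1 d \<noteq> {0}}}. F ds (map2 V1_part ds xs))"

definition multilinear :: "nat \<Rightarrow> ('v, 'k) form \<Rightarrow> bool" where
  "multilinear k \<Omega> \<longleftrightarrow>
     (\<forall>xs. length xs \<noteq> k \<longrightarrow> \<Omega> xs = 0) \<and>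
     (\<forall>xs i. length xs = k \<and> i < k \<longrightarrow> Vector_Spaces.linear scale (*) (\<lambda>x. \<Omega> (xs[i := x])))"

definition cyclic :: "('v, 'k) form \<Rightarrow> bool" where
  "cyclic \<Omega> \<longleftrightarrow>
     (\<forall>xs ds y d. homogeneous xs ds \<and> y \<in> V1 d \<longrightarrow>
        \<Omega> (y # xs) = (-1) powi (d * sum_list ds) * \<Omega> (xs @ [y]))"

definition C :: "nat \<Rightarrow> ('v, 'k) form set" where
  "C k = {\<Omega>. multilinear k \<Omega> \<and> cyclic \<Omega>}"

definition CV :: "('v, 'k) form set" where
  "CV = module.span fscale (\<Union>k. C k)"

text \<open>The degree of a form is its degree as a map to the field, which sits in degree 0.\<close>

definition has_degree :: "('v, 'k) form \<Rightarrow> int \<Rightarrow> bool" where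
  "has_degree \<Omega> n \<longleftrightarrow> (\<forall>xs ds. homogeneous xs ds \<and> \<Omega> xs \<noteq> 0 \<longrightarrow> n + sum_list ds = 0)"

text \<open>The component of degree \<open>n\<close> for the grading \<open>deg - 2\<close>.\<close>

definition CV_gr :: "int \<Rightarrow> ('v, 'k) form set" where
  "CV_gr n = {\<Omega> \<in> CV. has_degree \<Omega> (n + 2)}"

definition Cycl :: "('v, 'k) form \<Rightarrow> ('v, 'k) form" where
  "Cycl \<Omega> = extend (\<lambda>ds xs. \<Sum>\<tau> \<in> cyclic_perms (length xs). koszul ds \<tau> * \<Omega> (permute_list \<tau> xs))"

text \<open>In \<open>(A \<otimes> B)(x\<^sub>1,\<dots>,x\<^sub>n) = \<plusminus> A(x\<^sub>1,\<dots>,x\<^sub>p) B(x\<^sub>p\<^sub>+\<^sub>1,\<dots>,x\<^sub>n)\<close> the letter \<open>B\<close> moves past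
  \<open>x\<^sub>1,\<dots>,x\<^sub>p\<close>. Only the component of \<open>B\<close> whose degree is opposite to that of
  \<open>x\<^sub>p\<^sub>+\<^sub>1,\<dots>,x\<^sub>n\<close> contributes, which gives the sign. The sum over \<open>p\<close> adds up the arities of \<open>A\<close>.\<close>

definition tensor :: "('v, 'k) form \<Rightarrow> ('v, 'k) form \<Rightarrow> ('v, 'k) form" where
  "tensor A B = extend (\<lambda>ds xs. \<Sum>p\<le>length xs.
     (-1) powi (sum_list (take p ds) * sum_list (drop p ds)) * A (take p xs) * B (drop p xs))"

definition odot :: "('v, 'k) form \<Rightarrow> ('v, 'k) form \<Rightarrow> ('v, 'k) form" where
  "odot A B = Cycl (tensor A B)"

definition tensor_list :: "('v, 'k) form list \<Rightarrow> ('v, 'k) form" where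
  "tensor_list \<beta>s = foldr tensor \<beta>s (\<lambda>xs. if xs = [] then 1 else 0)"

section \<open>Pinczon brackets\<close>

text \<open>The scalar \<open>{\<alpha>, \<beta>\<^sub>j}\<close> is the value of a 0-linear form at the empty list, and \<open>\<beta>\<^sub>j\<close> has
  been moved past \<open>\<beta>\<^sub>1,\<dots>,\<beta>\<^sub>j\<^sub>-\<^sub>1\<close>.\<close>

definition derivation_on_linear :: "(('v, 'k) form \<Rightarrow> ('v, 'k) form \<Rightarrow> ('v, 'k) form) \<Rightarrow> bool" where
  "derivation_on_linear br \<longleftrightarrow>
     (\<forall>\<alpha>\<in>C 1. \<forall>\<beta>s bs. \<beta>s \<noteq> [] \<and> set \<beta>s \<subseteq> C 1 \<and> list_all2 has_degree \<beta>s bs \<longrightarrow>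
        br \<alpha> (Cycl (tensor_list \<beta>s)) =
        (\<Sum>j<length \<beta>s. fscale ((-1) powi (bs ! j * sum_list (take j bs)) * br \<alpha> (\<beta>s ! j) [])
           (Cycl (tensor_list (take j \<beta>s @ drop (Suc j) \<beta>s)))))"

definition inner_form :: "('v \<Rightarrow> 'v \<Rightarrow> 'k) \<Rightarrow> bool" where
  "inner_form b \<longleftrightarrow>
     (\<forall>x. Vector_Spaces.linear scale (*) (b x) \<and> Vector_Spaces.linear scale (*) (\<lambda>y. b y x)) \<and>
     (\<forall>i j. \<forall>x\<in>gr i. \<forall>y\<in>gr j. b y x = (-1) powi (i * j) * b x y) \<and>
     (\<forall>i j. \<forall>x\<in>gr i. \<forall>y\<in>gr j. i + j \<noteq> 0 \<longrightarrow> b x y = 0) \<and>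
     (\<forall>x. (\<forall>y. b x y = 0) \<longrightarrow> x = 0)"

definition homogeneous_basis :: "nat \<Rightarrow> (nat \<Rightarrow> int) \<Rightarrow> (nat \<Rightarrow> 'v) \<Rightarrow> bool" where
  "homogeneous_basis N d e \<longleftrightarrow>
     (\<forall>i<N. e i \<in> V1 (d i)) \<and> inj_on e {..<N} \<and> independent (e ` {..<N}) \<and> span (e ` {..<N}) = UNIV"

definition dual_bases ::
  "('v \<Rightarrow> 'v \<Rightarrow> 'k) \<Rightarrow> nat \<Rightarrow> (nat \<Rightarrow> int) \<Rightarrow> (nat \<Rightarrow> 'v) \<Rightarrow> (nat \<Rightarrow> 'v) \<Rightarrow> bool" where
  "dual_bases b N d e e' \<longleftrightarrow>
     homogeneous_basis N d e \<and> (\<exists>d'. homogeneous_basis N d' e') \<and>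
     (\<forall>i<N. \<forall>j<N. b (e i) (e' j) = (if i = j then 1 else 0))"

text \<open>The formula \<open>{\<Omega>, \<Omega>'} = \<Sum>\<^sub>i \<plusminus> \<iota>\<^bsub>e i\<^esub> \<Omega> \<odot> \<iota>\<^bsub>e' i\<^esub> \<Omega>'\<close>; its sign is the one for moving \<open>e i\<close> past \<open>\<Omega>'\<close> when
  the letters \<open>\<Omega> \<Omega>' e\<^sub>i e'\<^sub>i\<close> are rearranged to \<open>\<Omega> e\<^sub>i \<Omega>' e'\<^sub>i\<close>.\<close>

definition bracket_of :: "('v \<Rightarrow> 'v \<Rightarrow> 'k) \<Rightarrow> (('v, 'k) form \<Rightarrow> ('v, 'k) form \<Rightarrow> ('v, 'k) form) \<Rightarrow> bool" where
  "bracket_of b br \<longleftrightarrow>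
     (\<exists>N d e e'. dual_bases b N d e e' \<and>
        (\<forall>\<Omega>\<in>CV. \<forall>n. \<forall>\<Omega>'\<in>CV. has_degree \<Omega>' n \<longrightarrow>
           br \<Omega> \<Omega>' = (\<Sum>i<N. fscale ((-1) powi (n * d i)) (odot (\<iota> (e i) \<Omega>) (\<iota> (e' i) \<Omega>')))))"

definition centre :: "(('v, 'k) form \<Rightarrow> ('v, 'k) form \<Rightarrow> ('v, 'k) form) \<Rightarrow> ('v, 'k) form set" where
  "centre br = {\<Omega> \<in> CV. \<forall>\<Omega>'\<in>CV. br \<Omega> \<Omega>' = 0}"

text \<open>Two clauses need care.
  The condition that the centre is \<open>C 0\<close> cannot be imposed literally: for \<open>V\<close> the field in degree 0
  and \<open>b x y = x * y\<close>, the 3-linear form \<open>x * y * z\<close> is central too. What is required is that constants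
  are central and that no nonzero linear form is.
  The last clause, that \<open>br\<close> is the bracket of a form \<open>b\<close>, is part of the notion because the other
  clauses do not imply it: they determine \<open>br\<close> only up to forms annihilated by all \<open>br \<alpha>\<close> with \<open>\<alpha>\<close>
  linear. If \<open>V\<close> is two-dimensional and concentrated in degree 0, there are further brackets satisfying
  those clauses, and for some of them \<open>CV_vsp\<close> below is not a subalgebra.\<close>

definition pinczon_bracket :: "(('v, 'k) form \<Rightarrow> ('v, 'k) form \<Rightarrow> ('v, 'k) form) \<Rightarrow> bool" where
  "pinczon_bracket br \<longleftrightarrow>
     (\<forall>k l. \<forall>A \<in> C (k + 1). \<forall>B \<in> C (l + 1). br A B \<in> C (k + l)) \<and>
     graded_lie_algebra fscale CV CV_gr br \<and>
     C 0 \<subseteq> centre br \<and> centre br \<inter> C 1 = {0} \<and>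
     derivation_on_linear br \<and>
     (\<exists>b. inner_form b \<and> bracket_of b br)"

section \<open>Forms vanishing on shuffle products\<close>

definition vanishes_on_shuffles :: "nat \<Rightarrow> ('v, 'k) form \<Rightarrow> bool" where
  "vanishes_on_shuffles k f \<longleftrightarrow>
     (\<forall>p xs ds. 0 < p \<and> p < k \<and> length xs = k \<and> homogeneous xs ds \<longrightarrow>
        (\<Sum>\<sigma> \<in> Sh p (k - p). koszul ds (inv \<sigma>) * f (permute_list (inv \<sigma>) xs)) = 0)"

text \<open>For 0-linear forms the condition is empty.\<close>

definition C_vsp :: "nat \<Rightarrow> ('v, 'k) form set" where
  "C_vsp n = {\<Omega> \<in> C n. \<forall>k y. n = k + 1 \<longrightarrow> vanishes_on_shuffles k (\<lambda>xs. \<Omega> (xs @ [y]))}"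

definition CV_vsp :: "('v, 'k) form set" where
  "CV_vsp = module.span fscale (\<Union>n. C_vsp n)"

end

end

theory Submission
  imports Defs
begin

text \<open>
  Evaluate \<open>{A, B}\<close> on \<open>x\<^sub>1, \<dots>, x\<^sub>n, y\<close>. Every rotation of these letters, cut into an argument of
  \<open>\<iota>\<^bsub>e i\<^esub> A\<close> and one of \<open>\<iota>\<^bsub>e' i\<^esub> B\<close>, has \<open>y\<close> in one of the two parts. If \<open>y\<close> is in the part of \<open>B\<close>, cyclicity
  of \<open>B\<close> turns the term into \<open>\<plusminus> A(e\<^sub>i, u\<^sub>2) B(u\<^sub>1, e'\<^sub>i, u\<^sub>3, y)\<close> with \<open>x = u\<^sub>1 u\<^sub>2 u\<^sub>3\<close>: the map
  \<open>\<phi> = A(e\<^sub>i, \<cdot>) e'\<^sub>i\<close> is inserted into \<open>B(\<cdot>, y)\<close> at all places. If \<open>y\<close> is in the part of \<open>A\<close>, the roles of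
  \<open>A\<close> and \<open>B\<close> are exchanged. So it is enough that inserting a map \<open>\<phi>\<close> that vanishes on shuffle products
  into a form that does so yields a form that does so. Deconcatenation is multiplicative for the
  shuffle product, hence the insertions of \<open>\<phi>\<close> into a shuffle product of \<open>u\<close> and \<open>v\<close> see shuffle
  products of subwords of \<open>u\<close> and \<open>v\<close>, and only those with an empty factor survive. What remains are
  shuffle products of \<open>v\<close> with insertions into \<open>u\<close>, and of \<open>u\<close> with insertions into \<open>v\<close>.
\<close>

section \<open>Signed shuffles of words\<close>

text \<open>Reading only the parity of an integer exponent turns the comparison of two products of
  signs into one goal about \<open>even\<close>.\<close>

definition psign :: "int \<Rightarrow> 'k::field" where
  "psign n = (if even n then 1 else - 1)"

lemma powi_minus_one_eq_psign: "(-1) powi n = (psign n :: 'k::field)"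
  by (cases "n \<ge> 0") (auto simp: psign_def power_int_def minus_one_power_iff even_nat_iff)

lemma psign_0 [simp]: "psign 0 = 1"
  by (simp add: psign_def)

lemma psign_add: "psign (m + n) = psign m * psign n"
  by (simp add: psign_def)

lemma psign_cong: "even (m + n) \<Longrightarrow> psign m = psign n"
  by (auto simp: psign_def)

text \<open>Shaped for \<open>ev_odot_iota\<close>: on the left stand the signs of the bracket, the
  rotation, the tensor product and one cyclic move, on the right a constant sign and the sign of an
  insertion.\<close>

lemma psign_regroup:
  "even (i + j + k + l + m + n) \<Longrightarrow>
     psign i * (psign j * (psign k * (x * (psign l * y)))) = psign m * (psign n * x * y)"
  by (auto simp: psign_def)

definition wdeg :: "(int \<times> 'a) list \<Rightarrow> int" where
  "wdeg w = sum_list (map fst w)"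

lemma wdeg_simps [simp]:
  "wdeg [] = 0" "wdeg (a # w) = fst a + wdeg w" "wdeg (v @ w) = wdeg v + wdeg w"
  by (simp_all add: wdeg_def)

lemma wdeg_mset_cong: "mset v = mset w \<Longrightarrow> wdeg v = wdeg w"
  unfolding wdeg_def by (metis mset_map sum_mset_sum_list)

text \<open>A letter is paired with its degree. \<open>shuffle_sum F u v\<close> is the value of the linear extension of
  \<open>F\<close> at the shuffle product of \<open>u\<close> and \<open>v\<close>.\<close>

fun shuffle_sum ::
  "((int \<times> 'a) list \<Rightarrow> 'k::field) \<Rightarrow> (int \<times> 'a) list \<Rightarrow> (int \<times> 'a) list \<Rightarrow> 'k" where
  "shuffle_sum F [] v = F v"
| "shuffle_sum F (a # u) [] = F (a # u)"
| "shuffle_sum F (a # u) (b # v) =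
     shuffle_sum (\<lambda>w. F (a # w)) u (b # v) +
     psign (fst b * wdeg (a # u)) * shuffle_sum (\<lambda>w. F (b # w)) (a # u) v"

lemma shuffle_sum_Nil2 [simp]: "shuffle_sum F u [] = F u"
  by (cases u) auto

text \<open>Only rearrangements of the letters of \<open>u\<close> and \<open>v\<close> are ever
  evaluated. Hence a sign that depends on the total degree of the word may be treated as a
  constant.\<close>

lemma shuffle_sum_cong:
  assumes "\<And>w. mset w = mset u + mset v \<Longrightarrow> F w = G w"
  shows "shuffle_sum F u v = shuffle_sum G u v"
  using assms
proof (induction F u v arbitrary: G rule: shuffle_sum.induct)
  case (3 F a u b v)
  have "shuffle_sum (\<lambda>w. F (a # w)) u (b # v) = shuffle_sum (\<lambda>w. G (a # w)) u (b # v)"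
    using "3.IH"(1)[of "\<lambda>w. G (a # w)"] "3.prems" by simp
  moreover have "shuffle_sum (\<lambda>w. F (b # w)) (a # u) v = shuffle_sum (\<lambda>w. G (b # w)) (a # u) v"
    using "3.IH"(2)[of "\<lambda>w. G (b # w)"] "3.prems" by simp
  ultimately show ?case by simp
qed simp_all

lemma shuffle_sum_mult_right: "shuffle_sum (\<lambda>w. F w * c) u v = shuffle_sum F u v * c"
  by (induction F u v rule: shuffle_sum.induct) (simp_all add: algebra_simps)

lemma shuffle_sum_mult_left: "shuffle_sum (\<lambda>w. c * F w) u v = c * shuffle_sum F u v"
  by (induction F u v rule: shuffle_sum.induct) (simp_all add: algebra_simps)

lemma shuffle_sum_add: "shuffle_sum (\<lambda>w. F w + G w) u v = shuffle_sum F u v + shuffle_sum G u v"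
  by (induction u v arbitrary: F G rule: shuffles.induct) (simp_all add: algebra_simps)

lemma shuffle_sum_zero [simp]: "shuffle_sum (\<lambda>w. 0) u v = 0"
  using shuffle_sum_mult_left[of 0 "\<lambda>w. 0" u v] by simp

lemma shuffle_sum_sum: "shuffle_sum (\<lambda>w. \<Sum>i\<in>I. F i w) u v = (\<Sum>i\<in>I. shuffle_sum (F i) u v)"
  by (induction I rule: infinite_finite_induct) (simp_all add: shuffle_sum_add)

text \<open>Graded commutativity of the shuffle product: exchanging the words exchanges the two
  branches of the recursion.\<close>

lemma shuffle_sum_commute: "shuffle_sum F u v = psign (wdeg u * wdeg v) * shuffle_sum F v u"
proof (induction F u v rule: shuffle_sum.induct)
  case (3 F a u b v)
  then show ?case
    by (simp only: shuffle_sum.simps) (auto simp: psign_def algebra_simps)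
qed simp_all

text \<open>Likewise \<open>cuts H w\<close> is the value of \<open>H\<close> at the deconcatenation coproduct of \<open>w\<close>.\<close>

definition cuts :: "('a list \<Rightarrow> 'a list \<Rightarrow> 'k::comm_monoid_add) \<Rightarrow> 'a list \<Rightarrow> 'k" where
  "cuts H w = (\<Sum>i\<le>length w. H (take i w) (drop i w))"

lemma cuts_Nil [simp]: "cuts H [] = H [] []"
  by (simp add: cuts_def)

lemma cuts_Cons: "cuts H (a # w) = H [] (a # w) + cuts (\<lambda>x y. H (a # x) y) w"
  by (simp add: cuts_def sum.atMost_Suc_shift del: sum.atMost_Suc)

lemma cuts_cong:
  assumes "\<And>x y. x @ y = w \<Longrightarrow> G x y = H x y"
  shows "cuts G w = cuts H w"
  unfolding cuts_def by (rule sum.cong) (simp_all add: assms)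

lemma cuts_add: "cuts (\<lambda>x y. G x y + H x y) w = cuts G w + cuts H w"
  by (simp add: cuts_def sum.distrib)

lemma cuts_mult_left: "cuts (\<lambda>x y. c * H x y) w = (c::'k::field) * cuts H w"
  by (simp add: cuts_def sum_distrib_left)

lemma cuts_commute: "cuts (\<lambda>a b. cuts (\<lambda>c d. H a b c d) v) u = cuts (\<lambda>c d. cuts (\<lambda>a b. H a b c d) u) v"
  unfolding cuts_def by (rule sum.swap)

lemma cuts_only_Nil: "cuts (\<lambda>x y. if x = [] then H x y else 0) w = H [] w"
  by (cases w) (simp_all add: cuts_Cons, simp add: cuts_def)

lemma cuts_only_outer_Nil:
  "cuts (\<lambda>a b. cuts (\<lambda>c d. if a = [] then H b c d else 0) v) u = cuts (H u) v"
  by (subst cuts_commute) (simp add: cuts_only_Nil)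

lemma shuffle_sum_cuts: "shuffle_sum (\<lambda>w. cuts (H w) x) u v = cuts (\<lambda>a b. shuffle_sum (\<lambda>w. H w a b) u v) x"
  by (simp add: cuts_def shuffle_sum_sum)

text \<open>The cut falls before \<open>y\<close> or after it. In \<open>ev_odot_iota\<close> this
  decides which of the two forms receives the marked letter.\<close>

lemma cuts_append_Cons:
  "cuts H (u @ y # v) = cuts (\<lambda>a b. H a (b @ y # v)) u + cuts (\<lambda>a b. H (u @ y # a) b) v"
  by (induction u arbitrary: H) (simp_all add: cuts_Cons add.assoc)

text \<open>Both sides sum over all ways to cut \<open>w\<close> into three consecutive
  pieces.\<close>

lemma cuts_coassoc:
  "cuts (\<lambda>p q. cuts (\<lambda>a b. H a b q) p) w = cuts (\<lambda>p q. cuts (\<lambda>a b. H p a b) q) w"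
  by (induction w arbitrary: H) (simp_all add: cuts_Cons cuts_add add.assoc)

text \<open>A cut of a shuffle of \<open>u\<close> and \<open>v\<close> separates a shuffle of
  initial segments \<open>u1\<close>, \<open>v1\<close> from a shuffle of the remainders; the sign
  comes from moving \<open>v1\<close> past \<open>u2\<close>. The induction peels off the first
  letter of the shuffled word, with the empty left piece set apart.\<close>

lemma shuffle_sum_deconcatenation:
  fixes H :: "(int \<times> 'a) list \<Rightarrow> (int \<times> 'a) list \<Rightarrow> 'k::field"
  shows "shuffle_sum (cuts H) u v =
   cuts (\<lambda>u1 u2. cuts (\<lambda>v1 v2.
     psign (wdeg v1 * wdeg u2) * shuffle_sum (\<lambda>w. shuffle_sum (H w) u2 v2) u1 v1) v) u"
proof (induction u v arbitrary: H rule: shuffles.induct)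
  case (3 a u b v)
  let ?S = "\<lambda>H u1 u2 v1 v2. shuffle_sum (\<lambda>w. shuffle_sum (H w) u2 v2) u1 v1"
  let ?T = "\<lambda>H u1 u2 v1 v2. psign (wdeg v1 * wdeg u2) * ?S H u1 u2 v1 v2"
  let ?Ha = "\<lambda>x. H (a # x)" and ?Hb = "\<lambda>x. H (b # x)"
  let ?e = "psign (fst b * wdeg (a # u)) :: 'k"
  have 1: "shuffle_sum (cuts ?Ha) u (b # v) =
      cuts (\<lambda>u1 u2. shuffle_sum (?Ha u1) u2 (b # v)) u +
      cuts (\<lambda>u1 u2. cuts (\<lambda>v1 v2. psign (wdeg (b # v1) * wdeg u2) * ?S ?Ha u1 u2 (b # v1) v2) v) u"
    unfolding "3.IH"(1) by (simp add: cuts_Cons cuts_add)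
  have 2: "?e * shuffle_sum (cuts ?Hb) (a # u) v =
      ?e * cuts (\<lambda>v1 v2. psign (wdeg v1 * wdeg (a # u)) * shuffle_sum (?Hb v1) (a # u) v2) v +
      ?e * cuts (\<lambda>u1 u2. cuts (\<lambda>v1 v2. ?T ?Hb (a # u1) u2 v1 v2) v) u"
    unfolding "3.IH"(2) by (simp add: cuts_Cons distrib_left)
  \<comment> \<open>These are the terms with \<open>u1\<close> empty: passing \<open>b\<close> and
    \<open>v1\<close> over all of \<open>a # u\<close> is passing \<open>b # v1\<close> over
    it.\<close>
  have 3: "?e * cuts (\<lambda>v1 v2. psign (wdeg v1 * wdeg (a # u)) * shuffle_sum (?Hb v1) (a # u) v2) v =
      cuts (\<lambda>v1 v2. ?T H [] (a # u) (b # v1) v2) v"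
    unfolding cuts_mult_left[symmetric] mult.assoc[symmetric] psign_add[symmetric] shuffle_sum.simps(1)
    by (intro cuts_cong arg_cong2[where f = "(*)"] refl psign_cong) auto
  \<comment> \<open>The sign for moving \<open>b\<close> over \<open>a # u\<close> factors: the part
    over \<open>a # u1\<close> belongs to the inner shuffle, the part over \<open>u2\<close> to the
    cut.\<close>
  have 4: "?e * cuts (\<lambda>u1 u2. cuts (\<lambda>v1 v2. ?T ?Hb (a # u1) u2 v1 v2) v) u =
      cuts (\<lambda>u1 u2. cuts (\<lambda>v1 v2. psign (wdeg (b # v1) * wdeg u2) *
        (psign (fst b * wdeg (a # u1)) * ?S ?Hb (a # u1) u2 v1 v2)) v) u"
    unfolding cuts_mult_left[symmetric] mult.assoc[symmetric] psign_add[symmetric]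
    by (intro cuts_cong arg_cong2[where f = "(*)"] refl psign_cong) auto
  have 5: "shuffle_sum (cuts H) (a # u) (b # v) =
      shuffle_sum (\<lambda>w. H [] (a # w)) u (b # v) + shuffle_sum (cuts ?Ha) u (b # v) +
      ?e * (shuffle_sum (\<lambda>w. H [] (b # w)) (a # u) v + shuffle_sum (cuts ?Hb) (a # u) v)"
    by (simp add: cuts_Cons shuffle_sum_add)
  show ?case
    unfolding 5 distrib_left 1 2 3 4
    by (simp add: cuts_Cons cuts_add distrib_left add_ac)
qed simp_all

text \<open>In a shuffle, the position of the marked letter \<open>c\<close> cuts \<open>v\<close>
  into the letters \<open>v1\<close> before it and the letters \<open>v3\<close> after it. The
  former have jumped over \<open>c # u3\<close>, hence the sign.\<close>

lemma shuffle_sum_middle: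
  fixes F :: "(int \<times> 'a) list \<Rightarrow> 'k::field"
  shows "shuffle_sum F (u1 @ c # u3) v =
   cuts (\<lambda>v1 v3. psign (wdeg v1 * wdeg (c # u3)) *
     shuffle_sum (\<lambda>w1. shuffle_sum (\<lambda>w3. F (w1 @ c # w3)) u3 v3) u1 v1) v"
proof (induction u1 v arbitrary: F rule: shuffles.induct)
  case (1 v)
  show ?case
  proof (induction v arbitrary: F)
    case (Cons b v)
    let ?R = "\<lambda>v1 v3. shuffle_sum (\<lambda>w3. F (b # v1 @ c # w3)) u3 v3"
    have "psign (fst b * wdeg (c # u3)) * shuffle_sum (\<lambda>w. F (b # w)) (c # u3) v =
        psign (fst b * wdeg (c # u3)) * cuts (\<lambda>v1 v3. psign (wdeg v1 * wdeg (c # u3)) * ?R v1 v3) v"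
      using Cons[of "\<lambda>w. F (b # w)"] by simp
    also have "\<dots> = cuts (\<lambda>v1 v3. psign (wdeg (b # v1) * wdeg (c # u3)) * ?R v1 v3) v"
      unfolding cuts_mult_left[symmetric] mult.assoc[symmetric] psign_add[symmetric]
      by (intro cuts_cong arg_cong2[where f = "(*)"] refl psign_cong) auto
    finally show ?case
      by (simp add: cuts_Cons)
  qed simp
next
  case (3 a u b v)
  let ?S = "\<lambda>F u1 v1 v3. shuffle_sum (\<lambda>w1. shuffle_sum (\<lambda>w3. F (w1 @ c # w3)) u3 v3) u1 v1"
  let ?Fa = "\<lambda>w. F (a # w)" and ?Fb = "\<lambda>w. F (b # w)"
  let ?e = "psign (fst b * wdeg (a # u @ c # u3)) :: 'k"
  have 1: "shuffle_sum ?Fa (u @ c # u3) (b # v) = shuffle_sum (\<lambda>w. F (a # u @ c # w)) u3 (b # v) +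
      cuts (\<lambda>v1 v3. psign (wdeg (b # v1) * wdeg (c # u3)) * ?S ?Fa u (b # v1) v3) v"
    unfolding "3.IH"(1) by (simp add: cuts_Cons)
  have "?e * shuffle_sum ?Fb (a # u @ c # u3) v =
      cuts (\<lambda>v1 v3. ?e * (psign (wdeg v1 * wdeg (c # u3)) * ?S ?Fb (a # u) v1 v3)) v"
    using "3.IH"(2)[of ?Fb] by (simp only: cuts_mult_left append_Cons)
  also have "\<dots> = cuts (\<lambda>v1 v3. psign (wdeg (b # v1) * wdeg (c # u3)) *
      (psign (fst b * wdeg (a # u)) * ?S ?Fb (a # u) v1 v3)) v"
    unfolding mult.assoc[symmetric] psign_add[symmetric]
    by (intro cuts_cong arg_cong2[where f = "(*)"] refl psign_cong) auto
  finally have 2: "?e * shuffle_sum ?Fb (a # u @ c # u3) v = \<dots>" .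
  have "shuffle_sum F ((a # u) @ c # u3) (b # v) =
      shuffle_sum ?Fa (u @ c # u3) (b # v) + ?e * shuffle_sum ?Fb (a # u @ c # u3) v"
    by simp
  then show ?case
    unfolding 1 2 by (simp add: cuts_Cons cuts_add distrib_left add_ac)
qed simp

text \<open>By \<open>parity\<close>, replacing a subword \<open>p\<close> by \<open>c\<close> with
  coefficient \<open>\<phi> p\<close> is an operation of parity \<open>a\<close>, and
  \<open>psign (a * wdeg w3)\<close> is the sign for moving it past \<open>w3\<close>. This makes
  the signs of \<open>c\<close> agree with those of the subword that it replaces.\<close>

lemma shuffle_sum_insertion:
  fixes F \<phi> :: "(int \<times> 'a) list \<Rightarrow> 'k::field"
  assumes u: "u \<noteq> []" "set u \<subseteq> L" and v: "v \<noteq> []" "set v \<subseteq> L" and c: "c \<in> L"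
    and F: "\<And>p q. p \<noteq> [] \<Longrightarrow> q \<noteq> [] \<Longrightarrow> set p \<subseteq> L \<Longrightarrow> set q \<subseteq> L \<Longrightarrow> shuffle_sum F p q = 0"
    and \<phi>: "\<And>p q. p \<noteq> [] \<Longrightarrow> q \<noteq> [] \<Longrightarrow> set p \<subseteq> L \<Longrightarrow> set q \<subseteq> L \<Longrightarrow> shuffle_sum \<phi> p q = 0"
    and parity: "\<And>p. set p \<subseteq> L \<Longrightarrow> \<phi> p \<noteq> 0 \<Longrightarrow> even (a + wdeg p + fst c)"
  shows "shuffle_sum (cuts (\<lambda>w1. cuts (\<lambda>w2 w3. psign (a * wdeg w3) * \<phi> w2 * F (w1 @ c # w3)))) u v = 0"
proof -
  \<comment> \<open>\<open>M\<close> collects the shuffles on both sides of a fixed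
    \<open>c\<close>. Its signed sum over the cuts of one word is a shuffle with \<open>c\<close>
    inside the other word, by \<open>shuffle_sum_middle\<close>.\<close>
  define M where "M = (\<lambda>u1 u3 v1 v3.
    shuffle_sum (\<lambda>w1. shuffle_sum (\<lambda>w3. F (w1 @ c # w3)) u3 v3) u1 v1)"
  have inner: "shuffle_sum (\<lambda>w2. shuffle_sum (\<lambda>w3. psign (a * wdeg w3) * \<phi> w2 * F (w1 @ c # w3)) u3 v3) u2 v2
      = psign (a * (wdeg u3 + wdeg v3)) * shuffle_sum \<phi> u2 v2 * shuffle_sum (\<lambda>w3. F (w1 @ c # w3)) u3 v3"
    for w1 u2 u3 v2 v3
  proof -
    have "shuffle_sum (\<lambda>w3. psign (a * wdeg w3) * \<phi> w2 * F (w1 @ c # w3)) u3 v3 =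
        shuffle_sum (\<lambda>w3. (psign (a * (wdeg u3 + wdeg v3)) * \<phi> w2) * F (w1 @ c # w3)) u3 v3" for w2
      by (rule shuffle_sum_cong) (use wdeg_mset_cong[of _ "u3 @ v3"] in simp)
    then show ?thesis
      by (simp add: shuffle_sum_mult_left shuffle_sum_mult_right)
  qed
  \<comment> \<open>\<open>T1\<close> is the term whose replaced subword comes from \<open>u\<close>
    alone, \<open>T2\<close> the one where it comes from \<open>v\<close> alone. An empty subword is
    counted in \<open>T1\<close>, so \<open>T2\<close> is zero for \<open>v2 = []\<close>.\<close>
  define T1 where "T1 = (\<lambda>u1 u2 u3 v1 v3. psign (wdeg v1 * (wdeg u2 + wdeg u3)) *
    (psign (a * (wdeg u3 + wdeg v3)) * \<phi> u2 * M u1 u3 v1 v3))"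
  define T2 where "T2 = (\<lambda>u1 u3 v1 v2 v3. if v2 = [] then 0 else psign (wdeg v1 * wdeg u3) *
    (psign (wdeg v2 * wdeg u3) * (psign (a * (wdeg u3 + wdeg v3)) * \<phi> v2 * M u1 u3 v1 v3)))"
  have \<phi>_cases: "shuffle_sum \<phi> u2 v2 = (if v2 = [] then \<phi> u2 else if u2 = [] then \<phi> v2 else 0)"
    if "set u2 \<subseteq> L" "set v2 \<subseteq> L" for u2 v2
    using that \<phi>[of u2 v2] by auto
  \<comment> \<open>Two applications of the coproduct formula cut \<open>u\<close> and
    \<open>v\<close> into three pieces each.\<close>
  have "shuffle_sum (cuts (\<lambda>w1. cuts (\<lambda>w2 w3. psign (a * wdeg w3) * \<phi> w2 * F (w1 @ c # w3)))) u v =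
    cuts (\<lambda>u1 u'. cuts (\<lambda>v1 v'. psign (wdeg v1 * wdeg u') *
      cuts (\<lambda>u2 u3. cuts (\<lambda>v2 v3. psign (wdeg v2 * wdeg u3) * (psign (a * (wdeg u3 + wdeg v3)) *
        shuffle_sum \<phi> u2 v2 * M u1 u3 v1 v3)) v') u') v) u"
    unfolding shuffle_sum_deconcatenation inner shuffle_sum_cuts shuffle_sum_mult_left M_def ..
  also have "\<dots> = cuts (\<lambda>u1 u'. cuts (\<lambda>v1 v'.
      cuts (\<lambda>u2 u3. cuts (\<lambda>v2 v3. (if v2 = [] then T1 u1 u2 u3 v1 v3 else 0) +
         (if u2 = [] then T2 u1 u3 v1 v2 v3 else 0)) v') u') v) u"
    unfolding cuts_mult_left[symmetric]
  proof (intro cuts_cong, goal_cases)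
    case (1 u1 u' v1 v' u2 u3 v2 v3)
    then have "set u2 \<subseteq> L" "set v2 \<subseteq> L"
      using u v by auto
    then show ?case
      using 1 by (auto simp: \<phi>_cases T1_def T2_def)
  qed
  also have "\<dots> = cuts (\<lambda>u1 u'. cuts (\<lambda>v1 v'. cuts (\<lambda>u2 u3. T1 u1 u2 u3 v1 v') u') v) u +
      cuts (\<lambda>u1 u'. cuts (\<lambda>v1 v'. cuts (T2 u1 u' v1) v') v) u"
    unfolding cuts_add cuts_only_Nil cuts_only_outer_Nil ..
  \<comment> \<open>For fixed \<open>u1\<close>, \<open>u2\<close>, \<open>u3\<close> the sum over
    the cuts of \<open>v\<close> is a multiple of the shuffle of \<open>u1 @ c # u3\<close> with
    \<open>v\<close>, on which \<open>F\<close> vanishes.\<close>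
  also have "cuts (\<lambda>u1 u'. cuts (\<lambda>v1 v'. cuts (\<lambda>u2 u3. T1 u1 u2 u3 v1 v') u') v) u = 0"
  proof -
    have "cuts (\<lambda>u1 u'. cuts (\<lambda>v1 v'. cuts (\<lambda>u2 u3. T1 u1 u2 u3 v1 v') u') v) u =
        cuts (\<lambda>u1 u'. cuts (\<lambda>u2 u3. cuts (\<lambda>v1 v3. T1 u1 u2 u3 v1 v3) v) u') u"
      by (subst cuts_commute) rule
    also have "\<dots> = cuts (\<lambda>u1 u'. cuts (\<lambda>u2 u3. psign (a * (wdeg u3 + wdeg v)) * \<phi> u2 *
        shuffle_sum F (u1 @ c # u3) v) u') u"
    proof (intro cuts_cong, goal_cases)
      case (1 u1 u' u2 u3)
      \<comment> \<open>Where \<open>\<phi> u2\<close> is nonzero, \<open>parity\<close> replaces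
        \<open>wdeg u2\<close> by \<open>a + fst c\<close> modulo 2; the surplus
        \<open>a * wdeg v1\<close> completes \<open>wdeg v3\<close> to
        \<open>wdeg v\<close>.\<close>
      have "psign (wdeg v1 * (wdeg u2 + wdeg u3)) * psign (a * (wdeg u3 + wdeg v3)) =
          (psign (a * (wdeg u3 + wdeg v)) * psign (wdeg v1 * wdeg (c # u3)) :: 'k)"
        if "\<phi> u2 \<noteq> 0" "v1 @ v3 = v" for v1 v3
      proof -
        have "even (a + wdeg u2 + fst c)"
          using parity[OF _ that(1)] u 1 by auto
        moreover have "wdeg v = wdeg v1 + wdeg v3"
          using that(2) by auto
        ultimately show ?thesis
          unfolding psign_add[symmetric] by (intro psign_cong) auto
      qed
      then show ?case
        unfolding shuffle_sum_middle cuts_mult_left[symmetric] T1_def M_def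
        by (cases "\<phi> u2 = 0") (auto intro!: cuts_cong simp del: wdeg_simps simp: mult.assoc[symmetric] mult.commute[of _ "\<phi> u2"])
    qed
    also have "\<dots> = cuts (\<lambda>u1 u'. cuts (\<lambda>u2 u3. 0) u') u"
    proof (intro cuts_cong, goal_cases)
      case (1 u1 u' u2 u3)
      then have "shuffle_sum F (u1 @ c # u3) v = 0"
        using u v c by (intro F) auto
      then show ?case by simp
    qed
    finally show ?thesis by (simp add: cuts_def)
  qed
  \<comment> \<open>Now \<open>c\<close> stands among the letters of \<open>v\<close>, so both inner
    shuffles are commuted before \<open>shuffle_sum_middle\<close> applies with
    \<open>v1 @ c # v3\<close> as its first word.\<close>
  also have "cuts (\<lambda>u1 u'. cuts (\<lambda>v1 v'. cuts (T2 u1 u' v1) v') v) u = 0"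
  proof -
    have "cuts (\<lambda>u1 u'. cuts (\<lambda>v1 v'. cuts (T2 u1 u' v1) v') v) u =
        cuts (\<lambda>v1 v'. cuts (\<lambda>u1 u3. cuts (\<lambda>v2 v3. T2 u1 u3 v1 v2 v3) v') u) v"
      by (subst cuts_commute) rule
    also have "\<dots> = cuts (\<lambda>v1 v'. cuts (\<lambda>v2 v3. cuts (\<lambda>u1 u3. T2 u1 u3 v1 v2 v3) u) v') v"
      by (subst cuts_commute) rule
    also have "\<dots> = cuts (\<lambda>v1 v'. cuts (\<lambda>v2 v3. 0) v') v"
    proof (intro cuts_cong, goal_cases)
      case (1 v1 v' v2 v3)
      have par: "even (a + wdeg v2 + fst c)" if "\<phi> v2 \<noteq> 0"
        using parity[OF _ that] v 1 by auto
      have swap: "M u1 u3 v1 v3 = psign (wdeg u1 * wdeg v1) * (psign (wdeg u3 * wdeg v3) *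
          shuffle_sum (\<lambda>w1. shuffle_sum (\<lambda>w3. F (w1 @ c # w3)) v3 u3) v1 u1)" for u1 u3
        unfolding M_def shuffle_sum_commute[of _ u1 v1] shuffle_sum_commute[of _ u3 v3]
          shuffle_sum_mult_left ..
      have sign: "psign (wdeg v1 * wdeg u3) * psign (wdeg v2 * wdeg u3) * psign (a * (wdeg u3 + wdeg v3)) *
            psign (wdeg u1 * wdeg v1) * psign (wdeg u3 * wdeg v3) =
          (psign (a * wdeg v3 + wdeg u * (wdeg v1 + fst c + wdeg v3)) * psign (wdeg u1 * wdeg (c # v3)) :: 'k)"
        if "\<phi> v2 \<noteq> 0" "u1 @ u3 = u" for u1 u3
      proof -
        have "wdeg u = wdeg u1 + wdeg u3"
          using that(2) by auto
        then show ?thesis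
          using par[OF that(1)] unfolding psign_add[symmetric] by (intro psign_cong) auto
      qed
      have "cuts (\<lambda>u1 u3. T2 u1 u3 v1 v2 v3) u =
          (if v2 = [] then 0 else psign (a * wdeg v3 + wdeg u * (wdeg v1 + fst c + wdeg v3)) * \<phi> v2) *
          shuffle_sum F (v1 @ c # v3) u"
        unfolding shuffle_sum_middle cuts_mult_left[symmetric] T2_def swap
      proof (intro cuts_cong, goal_cases)
        case (1 u1 u3)
        show ?case
          using sign[OF _ 1] by (cases "\<phi> v2 = 0") (simp_all add: mult_ac)
      qed
      then show ?case
        using F[of "v1 @ c # v3" u] 1 u v c by auto
    qed
    finally show ?thesis by (simp add: cuts_def)
  qed
  finally show ?thesis by simp
qed

section \<open>Koszul signs of shuffles and rotations\<close>

text \<open>The Koszul sign of a list of positions, computed head first: the head is charged for the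
  smaller positions that follow it. This matches the recursion of \<open>shuffle_sum\<close>,
  whereas \<open>koszul\<close> counts all inversions at once.\<close>

fun inv_sign :: "int list \<Rightarrow> nat list \<Rightarrow> 'k::field" where
  "inv_sign ds [] = 1"
| "inv_sign ds (z # zs) =
     psign (\<Sum>w\<leftarrow>zs. if w < z then ds ! z * ds ! w else 0) * inv_sign ds zs"

lemma psign_sum_list: "psign (sum_list ns) = ((-1) ^ card {j. j < length ns \<and> odd (ns ! j)} :: 'k::field)"
proof (induction ns)
  case (Cons n ns)
  have "{j. j < length (n # ns) \<and> odd ((n # ns) ! j)} =
      (if odd n then {0} else {}) \<union> Suc ` {j. j < length ns \<and> odd (ns ! j)}"
  proof (rule set_eqI)
    fix j
    show "j \<in> {j. j < length (n # ns) \<and> odd ((n # ns) ! j)} \<longleftrightarrow>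
        j \<in> (if odd n then {0} else {}) \<union> Suc ` {j. j < length ns \<and> odd (ns ! j)}"
      by (cases j) auto
  qed
  moreover have "card ((if odd n then {0} else {}) \<union> Suc ` {j. j < length ns \<and> odd (ns ! j)}) =
      (if odd n then 1 else 0) + card {j. j < length ns \<and> odd (ns ! j)}"
    by (subst card_Un_disjoint) (auto simp: card_image)
  ultimately show ?case
    by (simp add: psign_add Cons.IH power_add psign_def[of n])
qed simp

lemma inv_sign_eq_card:
  "inv_sign ds zs = (-1) ^ card {(i, j). i < j \<and> j < length zs \<and> zs ! j < zs ! i \<and>
     odd (ds ! (zs ! i)) \<and> odd (ds ! (zs ! j))}"
proof (induction zs)
  case (Cons z zs)
  let ?A = "\<lambda>zs. {(i, j). i < j \<and> j < length zs \<and> zs ! j < zs ! i \<and>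
     odd (ds ! (zs ! i)) \<and> odd (ds ! (zs ! j))}"
  let ?f = "\<lambda>w. if w < z then ds ! z * ds ! w else 0"
  let ?J = "{j. j < length (map ?f zs) \<and> odd (map ?f zs ! j)}"
  \<comment> \<open>The inversions are sorted by whether they involve the first position.\<close>
  have "?A (z # zs) = (\<lambda>j. (0, Suc j)) ` ?J \<union> (\<lambda>(i, j). (Suc i, Suc j)) ` ?A zs"
  proof (rule set_eqI, unfold split_paired_all)
    fix i j
    show "(i, j) \<in> ?A (z # zs) \<longleftrightarrow> (i, j) \<in> (\<lambda>j. (0, Suc j)) ` ?J \<union> (\<lambda>(i, j). (Suc i, Suc j)) ` ?A zs"
      by (cases i; cases j) (auto simp: image_iff split: if_splits)
  qed
  moreover have "finite (?A zs)"
    by (rule finite_subset[of _ "{..<length zs} \<times> {..<length zs}"]) auto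
  ultimately have "card (?A (z # zs)) = card ?J + card (?A zs)"
    by (simp only:) (subst card_Un_disjoint, auto simp: card_image inj_on_def)
  then show ?case
    using Cons by (simp add: psign_sum_list power_add)
qed simp

lemma koszul_eq_inv_sign: "koszul ds \<tau> = inv_sign ds (map \<tau> [0..<length ds])"
proof -
  have "{(i, j). i < j \<and> j < length ds \<and> \<tau> j < \<tau> i \<and> odd (ds ! \<tau> i) \<and> odd (ds ! \<tau> j)} =
    {(i, j). i < j \<and> j < length (map \<tau> [0..<length ds]) \<and>
       map \<tau> [0..<length ds] ! j < map \<tau> [0..<length ds] ! i \<and>
       odd (ds ! (map \<tau> [0..<length ds] ! i)) \<and> odd (ds ! (map \<tau> [0..<length ds] ! j))}"
    by auto
  then show ?thesis
    by (simp add: koszul_def inv_sign_eq_card)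
qed

lemma sum_list_zero: "(\<And>x. x \<in> set xs \<Longrightarrow> f x = 0) \<Longrightarrow> (\<Sum>x\<leftarrow>xs. f x) = (0::int)"
  by (induction xs) auto

lemma inv_sign_sorted: "sorted zs \<Longrightarrow> inv_sign ds zs = 1"
proof (induction zs)
  case (Cons z zs)
  then have "(\<Sum>w\<leftarrow>zs. if w < z then ds ! z * ds ! w else 0) = 0"
    by (intro sum_list_zero) auto
  then show ?case
    using Cons by simp
qed simp

text \<open>Every pair across the two blocks is inverted, so its share of the exponent factors into
  the product of the total degrees. In a rotation both blocks are sorted and only this factor
  remains.\<close>

lemma inv_sign_append:
  assumes "\<And>x y. x \<in> set xs \<Longrightarrow> y \<in> set ys \<Longrightarrow> y < x"
  shows "inv_sign ds (xs @ ys) =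
    psign ((\<Sum>x\<leftarrow>xs. ds ! x) * (\<Sum>y\<leftarrow>ys. ds ! y)) * (inv_sign ds xs * inv_sign ds ys)"
  using assms
proof (induction xs)
  case (Cons x xs)
  have "(\<Sum>w\<leftarrow>ys. if w < x then ds ! x * ds ! w else 0) = (\<Sum>w\<leftarrow>ys. ds ! x * ds ! w)"
    using Cons.prems by (intro arg_cong[where f = sum_list] map_cong) auto
  also have "\<dots> = ds ! x * (\<Sum>y\<leftarrow>ys. ds ! y)"
    by (rule sum_list_const_mult)
  finally show ?case
    using Cons by (simp add: psign_add distrib_right distrib_left mult_ac)
qed simp

text \<open>A head taken from \<open>us\<close> is smaller than all later positions and costs no
  sign. A head \<open>v\<close> taken from \<open>vs\<close> has jumped over exactly the positions
  in \<open>u # us\<close>. These are the two branches of \<open>shuffle_sum\<close>.\<close>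

lemma shuffle_sum_eq_sum_shuffles:
  fixes F :: "(int \<times> 'a) list \<Rightarrow> 'k::field"
  assumes "sorted us" "sorted vs" "\<And>u v. u \<in> set us \<Longrightarrow> v \<in> set vs \<Longrightarrow> u < v"
    and g: "\<And>i. i \<in> set us \<union> set vs \<Longrightarrow> fst (g i) = ds ! i"
  shows "(\<Sum>zs\<in>shuffles us vs. inv_sign ds zs * F (map g zs)) = shuffle_sum F (map g us) (map g vs)"
  using assms
proof (induction us vs arbitrary: F rule: shuffles.induct)
  case (3 u us v vs)
  let ?A = "shuffles us (v # vs)" and ?B = "shuffles (u # us) vs"
  have "(\<Sum>zs\<in>shuffles (u # us) (v # vs). inv_sign ds zs * F (map g zs)) =
      (\<Sum>zs\<in>(#) u ` ?A. inv_sign ds zs * F (map g zs)) + (\<Sum>zs\<in>(#) v ` ?B. inv_sign ds zs * F (map g zs))"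
    unfolding shuffles.simps using "3.prems"(3)[of u v] by (intro sum.union_disjoint) auto
  also have "(\<Sum>zs\<in>(#) u ` ?A. inv_sign ds zs * F (map g zs)) =
      (\<Sum>zs\<in>?A. inv_sign ds zs * F (g u # map g zs))"
  proof (subst sum.reindex, simp, rule sum.cong, simp, goal_cases)
    case (1 zs)
    then have "set zs = set us \<union> set (v # vs)"
      by (rule set_shuffles)
    then have "(\<Sum>w\<leftarrow>zs. if w < u then ds ! u * ds ! w else 0) = 0"
      using "3.prems" by (intro sum_list_zero) fastforce
    then show ?case by simp
  qed
  also have "\<dots> = shuffle_sum (\<lambda>w. F (g u # w)) (map g us) (map g (v # vs))"
    using "3.prems" by (intro "3.IH"(1)) auto
  also have "(\<Sum>zs\<in>(#) v ` ?B. inv_sign ds zs * F (map g zs)) =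
      (\<Sum>zs\<in>?B. psign (fst (g v) * wdeg (map g (u # us))) * (inv_sign ds zs * F (g v # map g zs)))"
  proof (subst sum.reindex, simp, rule sum.cong, simp, goal_cases)
    case (1 zs)
    let ?f = "\<lambda>w. if w < v then ds ! v * ds ! w else 0"
    \<comment> \<open>The exponent depends only on the multiset of positions, so it may be evaluated
      on the unshuffled lists.\<close>
    have "sum_mset (image_mset ?f (mset zs)) = sum_mset (image_mset ?f (mset (u # us) + mset vs))"
      by (simp only: mset_shuffles[OF 1])
    then have "sum_list (map ?f zs) = sum_list (map ?f (u # us)) + sum_list (map ?f vs)"
      unfolding image_mset_union sum_mset.union mset_map[symmetric] sum_mset_sum_list .
    also have "sum_list (map ?f vs) = 0"
      using "3.prems"(2) by (intro sum_list_zero) auto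
    also have "map ?f (u # us) = map (\<lambda>w. fst (g v) * fst (g w)) (u # us)"
      using "3.prems" by (intro map_cong) auto
    also have "sum_list \<dots> = fst (g v) * wdeg (map g (u # us))"
      by (simp add: wdeg_def o_def sum_list_const_mult distrib_left)
    finally show ?case
      by (simp add: mult.assoc)
  qed
  also have "\<dots> = psign (fst (g v) * wdeg (map g (u # us))) *
      shuffle_sum (\<lambda>w. F (g v # w)) (map g (u # us)) (map g vs)"
    unfolding sum_distrib_left[symmetric] using "3.prems"
    by (intro arg_cong2[where f = "(*)"] refl "3.IH"(2)) auto
  finally show ?case by simp
qed (simp_all add: inv_sign_sorted del: inv_sign.simps)

section \<open>Shuffle permutations as interleavings of two intervals\<close>

lemma sorted_wrt_filter_iff: "sorted_wrt R (filter P zs) \<longleftrightarrow> sorted_wrt (\<lambda>x y. P x \<and> P y \<longrightarrow> R x y) zs"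
  by (induction zs) auto

text \<open>An interleaving of two disjoint lists is recognised by filtering out each of them, and a
  filtered part with the right elements is the interval as soon as it is increasing.\<close>

lemma shuffles_upt_iff:
  "zs \<in> shuffles [0..<p] [p..<p + q] \<longleftrightarrow> distinct zs \<and> set zs = {..<p + q} \<and>
     sorted_wrt (\<lambda>x y. x < p \<and> y < p \<longrightarrow> x < y) zs \<and>
     sorted_wrt (\<lambda>x y. \<not> x < p \<and> \<not> y < p \<longrightarrow> x < y) zs"
proof
  assume zs: "zs \<in> shuffles [0..<p] [p..<p + q]"
  have f1: "filter (\<lambda>x. x < p) zs = [0..<p]"
  proof -
    have "filter (\<lambda>x. x < p) zs = filter (\<lambda>x. x \<in> set [0..<p]) zs"
      by (rule filter_cong) auto
    then show ?thesis
      using filter_shuffles_disjoint1(1)[OF _ zs] by auto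
  qed
  have f2: "filter (\<lambda>x. \<not> x < p) zs = [p..<p + q]"
  proof -
    have "filter (\<lambda>x. \<not> x < p) zs = filter (\<lambda>x. x \<notin> set [0..<p]) zs"
      by (rule filter_cong) auto
    then show ?thesis
      using filter_shuffles_disjoint1(2)[OF _ zs] by auto
  qed
  have "sorted_wrt (<) (filter (\<lambda>x. x < p) zs)" "sorted_wrt (<) (filter (\<lambda>x. \<not> x < p) zs)"
    unfolding f1 f2 by simp_all
  then have "sorted_wrt (\<lambda>x y. x < p \<and> y < p \<longrightarrow> x < y) zs"
    "sorted_wrt (\<lambda>x y. \<not> x < p \<and> \<not> y < p \<longrightarrow> x < y) zs"
    by (simp_all only: sorted_wrt_filter_iff)
  moreover have "distinct zs"
    by (rule distinct_disjoint_shuffles[OF _ _ _ zs]) auto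
  moreover have "set zs = {..<p + q}"
    using set_shuffles[OF zs] by auto
  ultimately show "distinct zs \<and> set zs = {..<p + q} \<and>
     sorted_wrt (\<lambda>x y. x < p \<and> y < p \<longrightarrow> x < y) zs \<and>
     sorted_wrt (\<lambda>x y. \<not> x < p \<and> \<not> y < p \<longrightarrow> x < y) zs"
    by blast
next
  assume *: "distinct zs \<and> set zs = {..<p + q} \<and>
     sorted_wrt (\<lambda>x y. x < p \<and> y < p \<longrightarrow> x < y) zs \<and>
     sorted_wrt (\<lambda>x y. \<not> x < p \<and> \<not> y < p \<longrightarrow> x < y) zs"
  then have "sorted_wrt (<) (filter (\<lambda>x. x < p) zs)" "sorted_wrt (<) (filter (\<lambda>x. \<not> x < p) zs)"
    by (simp_all only: sorted_wrt_filter_iff)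
  moreover have "set (filter (\<lambda>x. x < p) zs) = set [0..<p]"
    "set (filter (\<lambda>x. \<not> x < p) zs) = set [p..<p + q]"
    by (auto simp: conjunct1[OF conjunct2[OF *]])
  ultimately have "filter (\<lambda>x. x < p) zs = [0..<p]" "filter (\<lambda>x. \<not> x < p) zs = [p..<p + q]"
    by (simp_all only: strict_sorted_equal sorted_wrt_upt)
  then show "zs \<in> shuffles [0..<p] [p..<p + q]"
    using partition_in_shuffles[of zs "\<lambda>x. x < p"] by simp
qed

text \<open>Position by position, the list names the index that \<sigma> sends there, so two members
  of \<open>A\<close> are in order in the list exactly if \<sigma> preserves their order.\<close>

lemma strict_mono_on_inv_iff:
  assumes "\<sigma> permutes {..<n}" "A \<subseteq> {..<n::nat}"
  shows "strict_mono_on A \<sigma> \<longleftrightarrow>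
    sorted_wrt (\<lambda>x y. x \<in> A \<and> y \<in> A \<longrightarrow> x < y) (map (inv \<sigma>) [0..<n])"
proof
  assume m: "strict_mono_on A \<sigma>"
  show "sorted_wrt (\<lambda>x y. x \<in> A \<and> y \<in> A \<longrightarrow> x < y) (map (inv \<sigma>) [0..<n])"
    unfolding sorted_wrt_iff_nth_less
  proof (intro allI impI, elim conjE)
    fix i j
    assume "i < j" "j < length (map (inv \<sigma>) [0..<n])"
    then have ij: "i < j" "j < n" by simp_all
    assume "map (inv \<sigma>) [0..<n] ! i \<in> A" "map (inv \<sigma>) [0..<n] ! j \<in> A"
    then have A: "inv \<sigma> i \<in> A" "inv \<sigma> j \<in> A" using ij by simp_all
    have "\<sigma> (inv \<sigma> i) < \<sigma> (inv \<sigma> j)"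
      using ij by (simp add: permutes_inverses(1)[OF assms(1)])
    then show "map (inv \<sigma>) [0..<n] ! i < map (inv \<sigma>) [0..<n] ! j"
      using ij strict_mono_on_less[OF m A] by simp
  qed
next
  assume s: "sorted_wrt (\<lambda>x y. x \<in> A \<and> y \<in> A \<longrightarrow> x < y) (map (inv \<sigma>) [0..<n])"
  show "strict_mono_on A \<sigma>"
  proof (rule strict_mono_onI)
    fix x y assume xy: "x \<in> A" "y \<in> A" "x < y"
    then have "\<sigma> x < n"
      using assms(2) permutes_in_image[OF assms(1), of x] by auto
    note inv = permutes_inverses(2)[OF assms(1)]
    show "\<sigma> x < \<sigma> y"
    proof (rule ccontr)
      assume "\<not> \<sigma> x < \<sigma> y"
      moreover have "\<sigma> x \<noteq> \<sigma> y"
        using xy(3) inv[of x] inv[of y] by (intro notI) simp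
      ultimately have "\<sigma> y < \<sigma> x" by simp
      then have "inv \<sigma> (\<sigma> y) < inv \<sigma> (\<sigma> x)"
        using sorted_wrt_nth_less[OF s, of "\<sigma> y" "\<sigma> x"] xy \<open>\<sigma> x < n\<close> by (simp add: inv)
      then show False
        using xy(3) by (simp add: inv)
    qed
  qed
qed

lemma Sh_iff_shuffles:
  assumes "\<sigma> permutes {..<p + q}"
  shows "\<sigma> \<in> Sh p q \<longleftrightarrow> map (inv \<sigma>) [0..<p + q] \<in> shuffles [0..<p] [p..<p + q]"
proof -
  let ?zs = "map (inv \<sigma>) [0..<p + q]"
  have perm: "inv \<sigma> permutes {..<p + q}"
    using assms by (rule permutes_inv)
  have set: "set ?zs = {..<p + q}"
    using permutes_image[OF perm] by (simp add: atLeast0LessThan)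
  have distinct: "distinct ?zs"
    using permutes_inj_on[OF perm] by (simp add: distinct_map)
  have 1: "strict_mono_on {..<p} \<sigma> \<longleftrightarrow> sorted_wrt (\<lambda>x y. x < p \<and> y < p \<longrightarrow> x < y) ?zs"
    using strict_mono_on_inv_iff[OF assms, of "{..<p}"] by simp
  have "inv \<sigma> i < p + q" if "i < p + q" for i
    using permutes_in_image[OF perm, of i] that by simp
  then have "sorted_wrt (\<lambda>x y. \<not> x < p \<and> \<not> y < p \<longrightarrow> x < y) ?zs \<longleftrightarrow>
      sorted_wrt (\<lambda>x y. x \<in> {p..<p + q} \<and> y \<in> {p..<p + q} \<longrightarrow> x < y) ?zs"
    by (simp add: sorted_wrt_iff_nth_less not_less)
  also have "\<dots> \<longleftrightarrow> strict_mono_on {p..<p + q} \<sigma>"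
    by (rule strict_mono_on_inv_iff[OF assms, symmetric]) (simp add: subset_iff)
  finally show ?thesis
    unfolding Sh_def mem_Collect_eq shuffles_upt_iff by (simp only: 1 assms set distinct simp_thms)
qed

lemma bij_betw_Sh_shuffles:
  "bij_betw (\<lambda>\<sigma>. map (inv \<sigma>) [0..<p + q]) (Sh p q) (shuffles [0..<p] [p..<p + q])"
proof (rule bij_betw_imageI)
  show "inj_on (\<lambda>\<sigma>. map (inv \<sigma>) [0..<p + q]) (Sh p q)"
  proof (rule inj_onI)
    fix \<sigma> \<sigma>'
    assume *: "\<sigma> \<in> Sh p q" "\<sigma>' \<in> Sh p q" "map (inv \<sigma>) [0..<p + q] = map (inv \<sigma>') [0..<p + q]"
    then have perm: "\<sigma> permutes {..<p + q}" "\<sigma>' permutes {..<p + q}"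
      by (simp_all add: Sh_def)
    have "inv \<sigma> i = inv \<sigma>' i" for i
    proof (cases "i < p + q")
      case True
      then show ?thesis using *(3) by simp
    next
      case False
      then show ?thesis
        using perm[THEN permutes_inv] by (simp add: permutes_def)
    qed
    then have "inv \<sigma> = inv \<sigma>'" by auto
    then show "\<sigma> = \<sigma>'"
      by (metis perm permutes_inv_inv)
  qed
  show "(\<lambda>\<sigma>. map (inv \<sigma>) [0..<p + q]) ` Sh p q = shuffles [0..<p] [p..<p + q]"
  proof (intro equalityI subsetI)
    fix zs assume zs: "zs \<in> shuffles [0..<p] [p..<p + q]"
    then have d: "distinct zs" "set zs = {..<p + q}" and len: "length zs = p + q"
      using length_shuffles[OF zs] by (simp_all add: shuffles_upt_iff)
    \<comment> \<open>The list is read as the one-line notation of a permutation that fixes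
      everything outside the range; the shuffle sought is its inverse.\<close>
    define \<tau> where "\<tau> i = (if i < p + q then zs ! i else i)" for i
    have "bij_betw ((!) zs) {..<p + q} {..<p + q}"
      using bij_betw_nth[OF d(1) _ d(2)[symmetric]] len by simp
    then have "bij_betw \<tau> {..<p + q} {..<p + q}"
      by (subst bij_betw_cong[of _ _ "(!) zs"]) (simp_all add: \<tau>_def)
    then have perm: "\<tau> permutes {..<p + q}"
      by (rule bij_imp_permutes) (simp add: \<tau>_def)
    have zs_eq: "zs = map (inv (inv \<tau>)) [0..<p + q]"
      using len by (auto simp: permutes_inv_inv[OF perm] \<tau>_def intro!: nth_equalityI)
    have "inv \<tau> \<in> Sh p q"
      using zs by (simp only: Sh_iff_shuffles[OF permutes_inv[OF perm]] zs_eq[symmetric])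
    then show "zs \<in> (\<lambda>\<sigma>. map (inv \<sigma>) [0..<p + q]) ` Sh p q"
      by (rule rev_image_eqI) (rule zs_eq)
  next
    fix zs assume "zs \<in> (\<lambda>\<sigma>. map (inv \<sigma>) [0..<p + q]) ` Sh p q"
    then obtain \<sigma> where "\<sigma> \<in> Sh p q" "zs = map (inv \<sigma>) [0..<p + q]" by auto
    moreover from this have "\<sigma> permutes {..<p + q}" by (simp add: Sh_def)
    ultimately show "zs \<in> shuffles [0..<p] [p..<p + q]"
      using Sh_iff_shuffles by blast
  qed
qed

text \<open>Both the Koszul sign and the rearranged list are read off the one-line notation of
  \<open>inv \<sigma>\<close>, so the sum can be reindexed by interleavings.\<close>

lemma sum_Sh_eq_shuffle_sum:
  fixes f :: "'a list \<Rightarrow> 'k::field"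
  assumes "length ds = length xs" "p \<le> length xs"
  shows "(\<Sum>\<sigma>\<in>Sh p (length xs - p). koszul ds (inv \<sigma>) * f (permute_list (inv \<sigma>) xs)) =
    shuffle_sum (\<lambda>w. f (map snd w)) (take p (zip ds xs)) (drop p (zip ds xs))"
proof -
  define n where "n = length xs"
  define q where "q = n - p"
  have n: "n = p + q"
    using assms by (simp add: n_def q_def)
  let ?g = "\<lambda>i. (ds ! i, xs ! i)"
  have "(\<Sum>\<sigma>\<in>Sh p q. koszul ds (inv \<sigma>) * f (permute_list (inv \<sigma>) xs)) =
    (\<Sum>\<sigma>\<in>Sh p q. (\<lambda>zs. inv_sign ds zs * f (map snd (map ?g zs))) (map (inv \<sigma>) [0..<p + q]))"
    using assms by (auto simp: koszul_eq_inv_sign permute_list_def n[symmetric] n_def o_def)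
  also have "\<dots> = (\<Sum>zs\<in>shuffles [0..<p] [p..<p + q]. inv_sign ds zs * f (map snd (map ?g zs)))"
    by (rule sum.reindex_bij_betw[OF bij_betw_Sh_shuffles])
  also have "\<dots> = shuffle_sum (\<lambda>w. f (map snd w)) (map ?g [0..<p]) (map ?g [p..<p + q])"
    by (rule shuffle_sum_eq_sum_shuffles) auto
  also have "map ?g [0..<p] = take p (zip ds xs)"
    using assms by (auto intro!: nth_equalityI)
  also have "map ?g [p..<p + q] = drop p (zip ds xs)"
    using assms n n_def by (auto intro!: nth_equalityI)
  finally show ?thesis
    by (simp add: q_def n_def)
qed

text \<open>The rotations by \<open>r\<close> and by \<open>r mod n\<close> agree, so
  \<open>r < n\<close> lists each of them once. For the empty list the left side would have one term
  and the right side none.\<close>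

lemma sum_cyclic_perms:
  fixes f :: "'a list \<Rightarrow> 'k::field"
  assumes len: "length ds = length xs" and "xs \<noteq> []"
  shows "(\<Sum>\<tau>\<in>cyclic_perms (length xs). koszul ds \<tau> * f (permute_list \<tau> xs)) =
    (\<Sum>r<length xs. psign (sum_list (take r ds) * sum_list (drop r ds)) * f (drop r xs @ take r xs))"
proof -
  define n where "n = length xs"
  have "n > 0"
    using assms by (simp add: n_def)
  define \<rho> where "\<rho> r i = (if i < n then (i + r) mod n else i)" for r i :: nat
  have cp: "cyclic_perms n = \<rho> ` {..<n}"
  proof -
    have "\<rho> r \<in> \<rho> ` {..<n}" for r
      using \<open>n > 0\<close> by (intro image_eqI[of _ _ "r mod n"]) (auto simp: \<rho>_def mod_add_right_eq)
    then have "range \<rho> = \<rho> ` {..<n}" by auto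
    moreover have "cyclic_perms n = range \<rho>"
      by (simp add: cyclic_perms_def \<rho>_def[abs_def])
    ultimately show ?thesis by simp
  qed
  have inj: "inj_on \<rho> {..<n}"
  proof (rule inj_onI)
    fix r s assume rs: "r \<in> {..<n}" "s \<in> {..<n}" and "\<rho> r = \<rho> s"
    then have "\<rho> r 0 = \<rho> s 0" by simp
    then show "r = s"
      using rs by (simp add: \<rho>_def)
  qed
  have "(\<Sum>\<tau>\<in>cyclic_perms n. koszul ds \<tau> * f (permute_list \<tau> xs)) =
      (\<Sum>r<n. koszul ds (\<rho> r) * f (permute_list (\<rho> r) xs))"
    unfolding cp by (simp add: sum.reindex[OF inj])
  also have "\<dots> = (\<Sum>r<n. psign (sum_list (take r ds) * sum_list (drop r ds)) * f (drop r xs @ take r xs))"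
  proof (rule sum.cong[OF refl])
    fix r assume "r \<in> {..<n}"
    then have r: "r < n" by simp
    \<comment> \<open>In one-line notation a rotation exchanges two increasing blocks, so
      \<open>inv_sign_append\<close> gives its sign.\<close>
    have map: "map (\<rho> r) [0..<n] = [r..<n] @ [0..<r]"
    proof (rule nth_equalityI)
      fix i assume "i < length (map (\<rho> r) [0..<n])"
      then have i: "i < n" by simp
      have "(i + r) mod n = (if i < n - r then i + r else i + r - n)"
      proof (cases "i < n - r")
        case False
        then have "n \<le> i + r" by linarith
        then show ?thesis
          using False i r by (simp add: le_mod_geq)
      qed simp
      then show "map (\<rho> r) [0..<n] ! i = ([r..<n] @ [0..<r]) ! i"
        using i r by (auto simp: \<rho>_def nth_append)
    qed (use r in simp)
    have nths: "map ((!) ys) [0..<r] = take r ys" "map ((!) ys) [r..<n] = drop r ys"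
      if "length ys = n" for ys :: "'b list"
      using that r by (auto intro!: nth_equalityI)
    have "inv_sign ds ([r..<n] @ [0..<r]) =
        psign (sum_list (map ((!) ds) [r..<n]) * sum_list (map ((!) ds) [0..<r])) *
        (inv_sign ds [r..<n] * inv_sign ds [0..<r] :: 'k)"
      by (rule inv_sign_append) auto
    then have "koszul ds (\<rho> r) = (psign (sum_list (take r ds) * sum_list (drop r ds)) :: 'k)"
      using len by (simp add: koszul_eq_inv_sign n_def[symmetric] map inv_sign_sorted nths mult.commute)
    moreover have "permute_list (\<rho> r) xs = map ((!) xs) (map (\<rho> r) [0..<n])"
      by (simp add: permute_list_def n_def)
    then have "permute_list (\<rho> r) xs = drop r xs @ take r xs"
      by (simp only: map map_append nths[OF n_def[symmetric]])
    ultimately show "koszul ds (\<rho> r) * f (permute_list (\<rho> r) xs) =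
        psign (sum_list (take r ds) * sum_list (drop r ds)) * f (drop r xs @ take r xs)"
      by simp
  qed
  finally show ?thesis by (simp add: n_def)
qed

section \<open>Graded subspaces\<close>

text \<open>Cancellation may shrink the support of the sum, so all sums are first taken over the
  union of the two supports.\<close>

lemma sum_support_add:
  fixes c c' :: "'i \<Rightarrow> 'f::ab_group_add"
  assumes "finite {n. c n \<noteq> 0}" "finite {n. c' n \<noteq> 0}"
  shows "finite {n. c n + c' n \<noteq> 0}"
    and "(\<Sum>n | c n + c' n \<noteq> 0. c n + c' n) = (\<Sum>n | c n \<noteq> 0. c n) + (\<Sum>n | c' n \<noteq> 0. c' n)"
proof -
  let ?S = "{n. c n \<noteq> 0} \<union> {n. c' n \<noteq> 0}"
  have sub: "{n. c n + c' n \<noteq> 0} \<subseteq> ?S" by auto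
  have fin: "finite ?S" using assms by simp
  show "finite {n. c n + c' n \<noteq> 0}"
    using sub fin by (rule finite_subset)
  have "(\<Sum>n | c n + c' n \<noteq> 0. c n + c' n) = (\<Sum>n\<in>?S. c n + c' n)"
    using fin sub by (intro sum.mono_neutral_left) auto
  also have "\<dots> = (\<Sum>n\<in>?S. c n) + (\<Sum>n\<in>?S. c' n)"
    by (rule sum.distrib)
  also have "(\<Sum>n\<in>?S. c n) = (\<Sum>n | c n \<noteq> 0. c n)"
    using fin by (intro sum.mono_neutral_right) auto
  also have "(\<Sum>n\<in>?S. c' n) = (\<Sum>n | c' n \<noteq> 0. c' n)"
    using fin by (intro sum.mono_neutral_right) auto
  finally show "(\<Sum>n | c n + c' n \<noteq> 0. c n + c' n) = (\<Sum>n | c n \<noteq> 0. c n) + (\<Sum>n | c' n \<noteq> 0. c' n)" .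
qed

lemma (in module) sum_support_scale:
  assumes "finite {n. c n \<noteq> 0}"
  shows "finite {n. scale a (c n) \<noteq> 0}"
    and "(\<Sum>n | scale a (c n) \<noteq> 0. scale a (c n)) = scale a (\<Sum>n | c n \<noteq> 0. c n)"
proof -
  have sub: "{n. scale a (c n) \<noteq> 0} \<subseteq> {n. c n \<noteq> 0}" by auto
  show "finite {n. scale a (c n) \<noteq> 0}"
    using sub assms by (rule finite_subset)
  show "(\<Sum>n | scale a (c n) \<noteq> 0. scale a (c n)) = scale a (\<Sum>n | c n \<noteq> 0. c n)"
    unfolding scale_sum_right using assms sub by (intro sum.mono_neutral_left) auto
qed

lemma sum_support_single:
  fixes x :: "'f::comm_monoid_add"
  shows "finite {n. (if n = m then x else 0) \<noteq> 0}"
    and "(\<Sum>n | (if n = m then x else 0) \<noteq> 0. if n = m then x else 0) = x"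
proof -
  have sub: "{n. (if n = m then x else 0) \<noteq> 0} \<subseteq> {m}" by auto
  show "finite {n. (if n = m then x else 0) \<noteq> 0}"
    using sub by (rule finite_subset) simp
  have "(\<Sum>n | (if n = m then x else 0) \<noteq> 0. if n = m then x else 0) = (\<Sum>n\<in>{m}. if n = m then x else 0)"
    using sub by (intro sum.mono_neutral_left) auto
  then show "(\<Sum>n | (if n = m then x else 0) \<noteq> 0. if n = m then x else 0) = x" by simp
qed

text \<open>The elements whose components can be chosen inside the span form a subspace that
  contains the homogeneous generators, hence exhaust the span. Uniqueness is inherited from
  \<open>L\<close>.\<close>

lemma graded_space_span:
  assumes "module s" and gs: "graded_space s L G" and H: "\<And>x. x \<in> H \<Longrightarrow> \<exists>n. x \<in> G n"
  shows "module.span s H \<subseteq> L" "graded_space s (module.span s H) (\<lambda>n. module.span s H \<inter> G n)"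
proof -
  interpret module s by fact
  have subL: "subspace L" and subG: "\<And>n. subspace (G n)" and GL: "\<And>n. G n \<subseteq> L"
    and uniq: "\<And>x. x \<in> L \<Longrightarrow> \<exists>!c. (\<forall>n. c n \<in> G n) \<and> finite {n. c n \<noteq> 0} \<and> x = (\<Sum>n | c n \<noteq> 0. c n)"
    using gs unfolding graded_space_def by auto
  show L: "span H \<subseteq> L"
    using H GL by (intro span_minimal subL) blast
  define T where "T = {x. \<exists>c. (\<forall>n. c n \<in> span H \<inter> G n) \<and> finite {n. c n \<noteq> 0} \<and> x = (\<Sum>n | c n \<noteq> 0. c n)}"
  have sub_Int: "subspace (span H \<inter> G n)" for n
    by (intro subspace_inter subspace_span subG)
  have "subspace T"
  proof (rule subspaceI)
    show "0 \<in> T"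
      unfolding T_def using subspace_0[OF sub_Int] by (auto intro!: exI[of _ "\<lambda>n. 0"] simp: span_zero)
  next
    fix x y assume "x \<in> T" "y \<in> T"
    then obtain c c' where c: "\<And>n. c n \<in> span H \<inter> G n" "finite {n. c n \<noteq> 0}" "x = (\<Sum>n | c n \<noteq> 0. c n)"
      and c': "\<And>n. c' n \<in> span H \<inter> G n" "finite {n. c' n \<noteq> 0}" "y = (\<Sum>n | c' n \<noteq> 0. c' n)"
      unfolding T_def by blast
    have "c n + c' n \<in> span H \<inter> G n" for n
      using sub_Int c(1) c'(1) by (rule subspace_add)
    then show "x + y \<in> T"
      unfolding T_def c(3) c'(3) using sum_support_add[OF c(2) c'(2)]
      by (intro CollectI exI[of _ "\<lambda>n. c n + c' n"]) auto
  next
    fix a x assume "x \<in> T"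
    then obtain c where c: "\<And>n. c n \<in> span H \<inter> G n" "finite {n. c n \<noteq> 0}" "x = (\<Sum>n | c n \<noteq> 0. c n)"
      unfolding T_def by blast
    have "s a (c n) \<in> span H \<inter> G n" for n
      using sub_Int c(1) by (rule subspace_scale)
    then show "s a x \<in> T"
      unfolding T_def c(3) using sum_support_scale[OF c(2), of a]
      by (intro CollectI exI[of _ "\<lambda>n. s a (c n)"]) auto
  qed
  moreover have "H \<subseteq> T"
  proof
    fix x assume "x \<in> H"
    then obtain m where "x \<in> G m" "x \<in> span H"
      using H span_base by blast
    then show "x \<in> T"
      unfolding T_def using sum_support_single[of m x] subspace_0[OF sub_Int]
      by (intro CollectI exI[of _ "\<lambda>n. if n = m then x else 0"]) auto
  qed
  ultimately have "span H \<subseteq> T"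
    by (intro span_minimal)
  show "graded_space s (span H) (\<lambda>n. span H \<inter> G n)"
    unfolding graded_space_def
  proof (intro conjI allI ballI subspace_span sub_Int Int_lower1)
    fix x assume x: "x \<in> span H"
    then obtain c where c: "\<forall>n. c n \<in> span H \<inter> G n" "finite {n. c n \<noteq> 0}" "x = (\<Sum>n | c n \<noteq> 0. c n)"
      using \<open>span H \<subseteq> T\<close> unfolding T_def by blast
    show "\<exists>!c. (\<forall>n. c n \<in> span H \<inter> G n) \<and> finite {n. c n \<noteq> 0} \<and> x = (\<Sum>n | c n \<noteq> 0. c n)"
    proof (rule ex1I[of _ c])
      fix c' assume "(\<forall>n. c' n \<in> span H \<inter> G n) \<and> finite {n. c' n \<noteq> 0} \<and> x = (\<Sum>n | c' n \<noteq> 0. c' n)"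
      with c uniq[of x] x L show "c' = c" by blast
    qed (use c in blast)
  qed
qed

section \<open>Forms on homogeneous vectors\<close>

lemma module_fscale: "module (fscale :: 'k::field \<Rightarrow> ('v, 'k) form \<Rightarrow> ('v, 'k) form)"
  by unfold_locales (auto simp: fscale_def algebra_simps fun_eq_iff)

lemma sum_fun_apply: "(\<Sum>i\<in>I. f i) x = (\<Sum>i\<in>I. f i x)"
  by (induction I rule: infinite_finite_induct) auto

definition ev :: "('v, 'k) form \<Rightarrow> (int \<times> 'v) list \<Rightarrow> 'k" where
  "ev \<Omega> w = \<Omega> (map snd w)"

text \<open>The zero vector is homogeneous of every degree, so a formula with Koszul signs is
  unambiguous only if it vanishes on lists containing it. This weak trace of multilinearity is what
  evaluating \<open>extend\<close> takes.\<close>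

definition kills_zero :: "('v::zero, 'k::zero) form \<Rightarrow> bool" where
  "kills_zero \<Omega> \<longleftrightarrow> (\<forall>xs. 0 \<in> set xs \<longrightarrow> \<Omega> xs = 0)"

context fd_graded_vector_space
begin

section \<open>Homogeneous components in V[1] and the multilinear extension\<close>

lemma subspace_V1: "subspace (V1 n)"
  using graded by (simp add: graded_space_def V1_def)

lemma zero_in_V1 [simp]: "0 \<in> V1 n"
  using subspace_V1 by (rule subspace_0)

definition V1_decomp :: "(int \<Rightarrow> 'v) \<Rightarrow> 'v \<Rightarrow> bool" where
  "V1_decomp c x \<longleftrightarrow> (\<forall>n. c n \<in> V1 n) \<and> finite {n. c n \<noteq> 0} \<and> x = (\<Sum>n | c n \<noteq> 0. c n)"

text \<open>Reindexing by the degree shift transfers existence and uniqueness of components from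
  \<open>gr\<close> to \<open>V1\<close>.\<close>

lemma V1_decomp_iff_gr:
  "V1_decomp c x \<longleftrightarrow> (\<forall>n. c (n - 1) \<in> gr n) \<and> finite {n. c (n - 1) \<noteq> 0} \<and>
     x = (\<Sum>n | c (n - 1) \<noteq> 0. c (n - 1))"
proof -
  have supp: "{n. c n \<noteq> 0} = (\<lambda>n. n - 1) ` {n. c (n - 1) \<noteq> 0}"
    by (auto simp: image_iff) (metis add_diff_cancel_right')
  have "(\<forall>n. c n \<in> V1 n) \<longleftrightarrow> (\<forall>n. c (n - 1) \<in> gr n)"
    unfolding V1_def by (metis add_diff_cancel_right' diff_add_cancel)
  moreover have "finite {n. c n \<noteq> 0} \<longleftrightarrow> finite {n. c (n - 1) \<noteq> 0}"
    unfolding supp by (simp add: finite_image_iff inj_on_def)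
  moreover have "(\<Sum>n | c n \<noteq> 0. c n) = (\<Sum>n | c (n - 1) \<noteq> 0. c (n - 1))"
    unfolding supp by (subst sum.reindex) (simp_all add: inj_on_def)
  ultimately show ?thesis
    by (simp only: V1_decomp_def)
qed

lemma V1_decomp_unique: "V1_decomp c x \<Longrightarrow> V1_decomp c' x \<Longrightarrow> c = c'"
proof -
  have ex1_eqI: "Q x \<Longrightarrow> Q y \<Longrightarrow> x = y" if "\<exists>!x. Q x" for Q and x y :: "int \<Rightarrow> 'v"
    using that by blast
  let ?P = "\<lambda>g. (\<forall>n. g n \<in> gr n) \<and> finite {n. g n \<noteq> 0} \<and> x = (\<Sum>n | g n \<noteq> 0. g n)"
  assume "V1_decomp c x" "V1_decomp c' x"
  then have P: "?P (\<lambda>n. c (n - 1))" "?P (\<lambda>n. c' (n - 1))"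
    unfolding V1_decomp_iff_gr by - assumption+
  have "\<exists>!g. ?P g"
    using graded by (simp add: graded_space_def)
  then have "(\<lambda>n. c (n - 1)) = (\<lambda>n. c' (n - 1))"
    using P by (rule ex1_eqI)
  then have "c (n + 1 - 1) = c' (n + 1 - 1)" for n
    by (rule fun_cong)
  then show "c = c'" by (simp add: fun_eq_iff)
qed

lemma V1_part_eq: "V1_decomp c x \<Longrightarrow> V1_part d x = c d"
  unfolding V1_part_def V1_decomp_def[symmetric]
  by (rule fun_cong[of _ c]) (blast intro: the_equality V1_decomp_unique)

lemma V1_decomp_V1_part: "V1_decomp (\<lambda>n. V1_part n x) x"
proof -
  have "\<exists>!c. (\<forall>n. c n \<in> gr n) \<and> finite {n. c n \<noteq> 0} \<and> x = (\<Sum>n | c n \<noteq> 0. c n)"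
    using graded by (simp add: graded_space_def)
  then obtain c where "(\<forall>n. c n \<in> gr n) \<and> finite {n. c n \<noteq> 0} \<and> x = (\<Sum>n | c n \<noteq> 0. c n)"
    by (rule ex1E)
  then have "V1_decomp (\<lambda>n. c (n + 1)) x"
    unfolding V1_decomp_iff_gr by simp
  then show ?thesis
    by (simp add: V1_part_eq)
qed

lemma V1_part_homogeneous: "x \<in> V1 d \<Longrightarrow> V1_part d' x = (if d' = d then x else 0)"
  by (rule V1_part_eq) (auto simp: V1_decomp_def sum_support_single)

lemma V1_part_zero [simp]: "V1_part d 0 = 0"
  using V1_part_homogeneous[of 0 d d] by simp

lemma V1_part_add: "V1_part d (x + y) = V1_part d x + V1_part d y"
proof (rule V1_part_eq)
  have "V1_decomp (\<lambda>n. V1_part n x) x" "V1_decomp (\<lambda>n. V1_part n y) y"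
    by (rule V1_decomp_V1_part)+
  then show "V1_decomp (\<lambda>d. V1_part d x + V1_part d y) (x + y)"
    unfolding V1_decomp_def
    using sum_support_add[of "\<lambda>n. V1_part n x" "\<lambda>n. V1_part n y"] subspace_add[OF subspace_V1] by simp
qed

lemma V1_part_scale: "V1_part d (scale a x) = scale a (V1_part d x)"
proof (rule V1_part_eq)
  have "V1_decomp (\<lambda>n. V1_part n x) x"
    by (rule V1_decomp_V1_part)
  then show "V1_decomp (\<lambda>d. scale a (V1_part d x)) (scale a x)"
    unfolding V1_decomp_def
    using sum_support_scale[of "\<lambda>n. V1_part n x" a] subspace_scale[OF subspace_V1] by simp
qed

text \<open>Each of the finitely many spanning vectors has finitely many components. In any other
  degree the linear map \<open>V1_part d\<close> vanishes identically, and with it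
  \<open>V1 d\<close>.\<close>

lemma finite_V1_support: "finite {d. V1 d \<noteq> {0}}"
proof -
  obtain B where B: "finite B" "span B = UNIV"
    using finite_dimensional by blast
  have "d \<in> (\<Union>b\<in>B. {d. V1_part d b \<noteq> 0})" if "V1 d \<noteq> {0}" for d
  proof (rule ccontr)
    assume "d \<notin> (\<Union>b\<in>B. {d. V1_part d b \<noteq> 0})"
    then have "B \<subseteq> {x. V1_part d x = 0}" by auto
    moreover have "subspace {x. V1_part d x = 0}"
      by (rule subspaceI) (simp_all add: V1_part_add V1_part_scale)
    ultimately have "V1_part d x = 0" for x
      using span_minimal[of B "{x. V1_part d x = 0}"] B(2) by auto
    then have "x = 0" if "x \<in> V1 d" for x
      using V1_part_homogeneous[OF that, of d] by simp
    then show False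
      using \<open>V1 d \<noteq> {0}\<close> zero_in_V1 by blast
  qed
  then have "{d. V1 d \<noteq> {0}} \<subseteq> (\<Union>b\<in>B. {d. V1_part d b \<noteq> 0})" by blast
  moreover have "finite {d. V1_part d b \<noteq> 0}" for b
    using V1_decomp_V1_part by (simp add: V1_decomp_def)
  ultimately show ?thesis
    using B(1) by (meson finite_UN_I finite_subset)
qed

lemma zero_in_map2_V1_part:
  assumes "0 \<in> set xs" "length ds = length xs"
  shows "0 \<in> set (map2 V1_part ds xs)"
proof -
  obtain i where "i < length xs" "xs ! i = 0"
    using assms(1) by (auto simp: in_set_conv_nth)
  then have "map2 V1_part ds xs ! i = 0" "i < length (map2 V1_part ds xs)"
    using assms(2) by simp_all
  then show ?thesis by (metis nth_mem)
qed

lemma extend_eq_0: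
  assumes "\<And>ds ys. length ds = length ys \<Longrightarrow> 0 \<in> set ys \<Longrightarrow> F ds ys = 0" "0 \<in> set xs"
  shows "extend F xs = 0"
  unfolding extend_def using assms by (intro sum.neutral) (auto intro!: assms(1) zero_in_map2_V1_part)

text \<open>Any other choice of degrees projects some entry to 0, where \<open>F\<close> vanishes.
  Lists containing 0 are treated apart because \<open>ds\<close> may then lie outside the index set
  of \<open>extend\<close>.\<close>

lemma extend_homogeneous:
  assumes hom: "homogeneous xs ds"
    and F: "\<And>ds ys. length ds = length ys \<Longrightarrow> 0 \<in> set ys \<Longrightarrow> F ds ys = 0"
  shows "extend F xs = F ds xs"
proof (cases "0 \<in> set xs")
  case True
  then show ?thesis
    using extend_eq_0[OF F] F[of ds xs] hom by (simp add: homogeneous_def list_all2_lengthD)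
next
  case False
  have len: "length ds = length xs"
    using hom by (simp add: homogeneous_def list_all2_lengthD)
  have V1: "xs ! i \<in> V1 (ds ! i)" if "i < length xs" for i
    using hom that by (simp add: homogeneous_def list_all2_conv_all_nth)
  let ?I = "{es. length es = length xs \<and> set es \<subseteq> {d. V1 d \<noteq> {0}}}"
  have "finite ?I"
    using finite_lists_length_eq[OF finite_V1_support, of "length xs"] by (simp add: conj_commute)
  moreover have "ds \<in> ?I"
  proof -
    have "V1 d \<noteq> {0}" if d: "d \<in> set ds" for d
    proof -
      obtain i where i: "i < length xs" "d = ds ! i"
        using d len by (auto simp: in_set_conv_nth)
      then have "xs ! i \<in> V1 d" "xs ! i \<noteq> 0"
        using V1 False by (auto simp: in_set_conv_nth)
      then show ?thesis by blast
    qed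
    then show ?thesis using len by blast
  qed
  moreover have "F es (map2 V1_part es xs) = 0" if "es \<in> ?I - {ds}" for es
  proof (rule F)
    have es: "length es = length xs" "es \<noteq> ds"
      using that by auto
    then obtain i where i: "i < length xs" "es ! i \<noteq> ds ! i"
      using len by (metis nth_equalityI)
    then have "map2 V1_part es xs ! i = 0" "i < length (map2 V1_part es xs)"
      using es V1_part_homogeneous[OF V1[OF i(1)]] by simp_all
    then show "0 \<in> set (map2 V1_part es xs)" by (metis nth_mem)
  qed (use that in simp)
  ultimately have "extend F xs = F ds (map2 V1_part ds xs)"
    unfolding extend_def by (subst sum.remove[of _ ds]) auto
  also have "map2 V1_part ds xs = xs"
    using len by (intro nth_equalityI) (simp_all add: V1_part_homogeneous[OF V1])
  finally show ?thesis .
qed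

section \<open>Words of homogeneous letters as test arguments for forms\<close>

definition letters :: "(int \<times> 'v) set" where
  "letters = {(d, x). x \<in> V1 d}"

lemma homogeneous_iff_letters: "homogeneous xs ds \<longleftrightarrow> length ds = length xs \<and> set (zip ds xs) \<subseteq> letters"
proof -
  have "homogeneous xs ds \<longleftrightarrow> list_all2 (\<lambda>d x. x \<in> V1 d) ds xs"
    by (auto simp: homogeneous_def list_all2_conv_all_nth)
  then show ?thesis
    by (auto simp: list_all2_iff letters_def)
qed

lemma homogeneous_word: "set w \<subseteq> letters \<Longrightarrow> homogeneous (map snd w) (map fst w)"
  by (simp add: homogeneous_iff_letters zip_map_fst_snd)

lemma word_of_homogeneous:
  assumes "homogeneous xs ds"
  obtains w where "set w \<subseteq> letters" "map snd w = xs" "map fst w = ds"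
  using assms that[of "zip ds xs"] by (simp add: homogeneous_iff_letters)

text \<open>Linearity without a fixed arity, hence stable under sums of forms of different arities
  such as the elements of \<open>CV\<close>.\<close>

definition slotwise_linear :: "('v, 'k) form \<Rightarrow> bool" where
  "slotwise_linear \<Omega> \<longleftrightarrow>
     (\<forall>xs i. i < length xs \<longrightarrow> Vector_Spaces.linear scale (*) (\<lambda>x. \<Omega> (xs[i := x])))"

lemma vector_space_mult: "vector_space ((*) :: 'k \<Rightarrow> 'k \<Rightarrow> 'k)"
  by unfold_locales (auto simp: algebra_simps)

lemma linear_form_iff:
  "Vector_Spaces.linear scale (*) f \<longleftrightarrow> (\<forall>x y. f (x + y) = f x + f y) \<and> (\<forall>c x. f (scale c x) = c * f x)"
  using vector_space_mult vector_space_axioms by (simp add: Vector_Spaces.linear_iff)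

lemma slotwise_linear_kills_zero:
  assumes "slotwise_linear \<Omega>"
  shows "kills_zero \<Omega>"
  unfolding kills_zero_def
proof (intro allI impI)
  fix xs :: "'v list" assume "0 \<in> set xs"
  then obtain i where i: "i < length xs" "xs ! i = 0"
    by (auto simp: in_set_conv_nth)
  then have "Vector_Spaces.linear scale (*) (\<lambda>x. \<Omega> (xs[i := x]))"
    using assms by (simp add: slotwise_linear_def)
  then have "\<Omega> (xs[i := scale 0 0]) = 0 * \<Omega> (xs[i := 0])"
    by (simp only: linear_form_iff)
  then show "\<Omega> xs = 0"
    using i by (simp add: list_update_same_conv[THEN iffD2])
qed

lemma multilinear_slotwise_linear: "multilinear k \<Omega> \<Longrightarrow> slotwise_linear \<Omega>"
  unfolding slotwise_linear_def
proof (intro allI impI)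
  fix xs :: "'v list" and i
  assume "multilinear k \<Omega>" "i < length xs"
  then show "Vector_Spaces.linear scale (*) (\<lambda>x. \<Omega> (xs[i := x]))"
    by (cases "length xs = k") (simp_all add: multilinear_def linear_form_iff)
qed

lemma C_subset_CV: "C n \<subseteq> CV"
proof -
  interpret F: module "fscale :: 'k \<Rightarrow> ('v, 'k) form \<Rightarrow> _" by (rule module_fscale)
  show ?thesis unfolding CV_def using F.span_superset by blast
qed

lemma subspace_slotwise_linear: "module.subspace fscale {\<Omega>. slotwise_linear \<Omega>}"
proof -
  interpret F: module "fscale :: 'k \<Rightarrow> ('v, 'k) form \<Rightarrow> _" by (rule module_fscale)
  show ?thesis
    by (rule F.subspaceI) (auto simp: slotwise_linear_def linear_form_iff fscale_def algebra_simps)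
qed

lemma slotwise_linear_CV: "\<Omega> \<in> CV \<Longrightarrow> slotwise_linear \<Omega>"
proof -
  interpret F: module "fscale :: 'k \<Rightarrow> ('v, 'k) form \<Rightarrow> _" by (rule module_fscale)
  have "CV \<subseteq> {\<Omega>. slotwise_linear \<Omega>}"
    unfolding CV_def using multilinear_slotwise_linear
    by (intro F.span_minimal subspace_slotwise_linear) (auto simp: C_def)
  then show "\<Omega> \<in> CV \<Longrightarrow> slotwise_linear \<Omega>" by blast
qed

lemma slotwise_linear_expand:
  assumes "slotwise_linear \<Omega>"
  shows "\<Omega> (xs @ y # ys) = (\<Sum>d | V1_part d y \<noteq> 0. \<Omega> (xs @ V1_part d y # ys))"
proof -
  let ?f = "\<lambda>x. \<Omega> ((xs @ y # ys)[length xs := x])"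
  have "Vector_Spaces.linear scale (*) ?f"
    using assms by (simp only: slotwise_linear_def length_append list.size)
  then interpret f: Vector_Spaces.linear scale "(*)" ?f .
  have y: "(\<Sum>d | V1_part d y \<noteq> 0. V1_part d y) = y"
    using V1_decomp_V1_part[of y] by (simp add: V1_decomp_def)
  have "?f (\<Sum>d | V1_part d y \<noteq> 0. V1_part d y) = (\<Sum>d | V1_part d y \<noteq> 0. ?f (V1_part d y))"
    by (rule f.sum)
  then have "?f y = (\<Sum>d | V1_part d y \<noteq> 0. ?f (V1_part d y))"
    by (simp only: y)
  then show ?thesis by simp
qed

lemma V1_part_letter: "(d, V1_part d y) \<in> letters"
  using V1_decomp_V1_part by (simp add: V1_decomp_def letters_def)

text \<open>The arguments are expanded into homogeneous components one at a time from the left;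
  \<open>w\<close> is the part already expanded.\<close>

lemma slotwise_linear_eq_0:
  assumes \<Omega>: "slotwise_linear \<Omega>"
    and "\<And>w. set w \<subseteq> letters \<Longrightarrow> length w = length xs \<Longrightarrow> ev \<Omega> w = 0"
  shows "\<Omega> xs = 0"
proof -
  have "\<Omega> (map snd w @ ys) = 0" if "set w \<subseteq> letters" "length w + length ys = length xs" for w ys
    using that
  proof (induction ys arbitrary: w)
    case Nil
    then show ?case using assms(2)[of w] by (simp add: ev_def)
  next
    case (Cons y ys)
    have "\<Omega> (map snd (w @ [(d, V1_part d y)]) @ ys) = 0" for d
      using Cons.prems V1_part_letter by (intro Cons.IH) auto
    then have "\<Omega> (map snd w @ V1_part d y # ys) = 0" for d by simp
    then show ?case
      by (subst slotwise_linear_expand[OF \<Omega>]) simp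
  qed
  from this[of "[]" xs] show ?thesis by simp
qed

section \<open>Degree, cyclicity and vanishing on shuffles in terms of words\<close>

lemma has_degree_ev:
  "has_degree \<Omega> n \<Longrightarrow> set w \<subseteq> letters \<Longrightarrow> ev \<Omega> w \<noteq> 0 \<Longrightarrow> n + wdeg w = 0"
  using homogeneous_word[of w] by (auto simp: has_degree_def ev_def wdeg_def)

lemma cyclic_iff_ev:
  "cyclic \<Omega> \<longleftrightarrow> (\<forall>w c. set w \<subseteq> letters \<and> c \<in> letters \<longrightarrow>
     ev \<Omega> (c # w) = psign (fst c * wdeg w) * ev \<Omega> (w @ [c]))"
proof
  assume "cyclic \<Omega>"
  then show "\<forall>w c. set w \<subseteq> letters \<and> c \<in> letters \<longrightarrow>
     ev \<Omega> (c # w) = psign (fst c * wdeg w) * ev \<Omega> (w @ [c])"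
    using homogeneous_word
    by (fastforce simp: cyclic_def ev_def letters_def wdeg_def powi_minus_one_eq_psign)
next
  assume *: "\<forall>w c. set w \<subseteq> letters \<and> c \<in> letters \<longrightarrow>
     ev \<Omega> (c # w) = psign (fst c * wdeg w) * ev \<Omega> (w @ [c])"
  show "cyclic \<Omega>"
    unfolding cyclic_def
  proof (intro allI impI, elim conjE)
    fix xs ds y d assume "homogeneous xs ds" and y: "y \<in> V1 d"
    then obtain w where "set w \<subseteq> letters" "map snd w = xs" "map fst w = ds"
      by (elim word_of_homogeneous)
    then show "\<Omega> (y # xs) = (-1) powi (d * sum_list ds) * \<Omega> (xs @ [y])"
      using *[rule_format, of w "(d, y)"] y
      by (simp add: ev_def letters_def wdeg_def powi_minus_one_eq_psign)
  qed
qed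

lemma cyclic_rotate:
  assumes "cyclic \<Omega>" "set v \<subseteq> letters" "set w \<subseteq> letters"
  shows "ev \<Omega> (v @ w) = psign (wdeg v * wdeg w) * ev \<Omega> (w @ v)"
  using assms(2,3)
proof (induction v arbitrary: w)
  case (Cons c v)
  have "ev \<Omega> (c # v @ w) = psign (fst c * wdeg (v @ w)) * ev \<Omega> (v @ w @ [c])"
    using assms(1)[unfolded cyclic_iff_ev, rule_format, of "v @ w" c] Cons.prems by simp
  also have "ev \<Omega> (v @ w @ [c]) = psign (wdeg v * wdeg (w @ [c])) * ev \<Omega> ((w @ [c]) @ v)"
    using Cons.prems by (intro Cons.IH) auto
  finally show ?case
    by (simp add: mult.assoc[symmetric] psign_add[symmetric])
       (intro disjI2 psign_cong, simp add: algebra_simps)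
qed simp

lemma vanishes_on_shuffles_iff:
  "vanishes_on_shuffles k f \<longleftrightarrow> (\<forall>u v. u \<noteq> [] \<and> v \<noteq> [] \<and> set u \<subseteq> letters \<and> set v \<subseteq> letters \<and>
     length u + length v = k \<longrightarrow> shuffle_sum (ev f) u v = 0)"
proof
  assume *: "vanishes_on_shuffles k f"
  show "\<forall>u v. u \<noteq> [] \<and> v \<noteq> [] \<and> set u \<subseteq> letters \<and> set v \<subseteq> letters \<and>
     length u + length v = k \<longrightarrow> shuffle_sum (ev f) u v = 0"
  proof (intro allI impI, elim conjE)
    fix u v :: "(int \<times> 'v) list"
    assume uv: "u \<noteq> []" "v \<noteq> []" "set u \<subseteq> letters" "set v \<subseteq> letters" "length u + length v = k"
    let ?xs = "map snd (u @ v)" and ?ds = "map fst (u @ v)"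
    have zip: "zip ?ds ?xs = u @ v"
      by (rule zip_map_fst_snd)
    have "0 < length u \<and> length u < k \<and> length ?xs = k \<and> homogeneous ?xs ?ds"
      using uv homogeneous_word[of "u @ v"] by auto
    then have "(\<Sum>\<sigma>\<in>Sh (length u) (k - length u). koszul ?ds (inv \<sigma>) * f (permute_list (inv \<sigma>) ?xs)) = 0"
      by (rule *[unfolded vanishes_on_shuffles_def, rule_format])
    moreover have "(\<Sum>\<sigma>\<in>Sh (length u) (length ?xs - length u). koszul ?ds (inv \<sigma>) * f (permute_list (inv \<sigma>) ?xs)) =
        shuffle_sum (\<lambda>w. f (map snd w)) (take (length u) (zip ?ds ?xs)) (drop (length u) (zip ?ds ?xs))"
      by (rule sum_Sh_eq_shuffle_sum) simp_all
    moreover have "length ?xs = k"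
      using uv by simp
    ultimately have "shuffle_sum (\<lambda>w. f (map snd w)) (take (length u) (zip ?ds ?xs)) (drop (length u) (zip ?ds ?xs)) = 0"
      by (simp only:)
    then show "shuffle_sum (ev f) u v = 0"
      unfolding zip ev_def[abs_def] by simp
  qed
next
  assume *: "\<forall>u v. u \<noteq> [] \<and> v \<noteq> [] \<and> set u \<subseteq> letters \<and> set v \<subseteq> letters \<and>
     length u + length v = k \<longrightarrow> shuffle_sum (ev f) u v = 0"
  show "vanishes_on_shuffles k f"
    unfolding vanishes_on_shuffles_def
  proof (intro allI impI, elim conjE)
    fix p and xs :: "'v list" and ds
    assume p: "0 < p" "p < k" and len: "length xs = k" and hom: "homogeneous xs ds"
    then have zip: "length ds = length xs" "set (zip ds xs) \<subseteq> letters"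
      by (simp_all add: homogeneous_iff_letters)
    have "shuffle_sum (ev f) (take p (zip ds xs)) (drop p (zip ds xs)) = 0"
      using p len zip set_take_subset[of p "zip ds xs"] set_drop_subset[of p "zip ds xs"]
      by (intro *[rule_format]) auto
    then show "(\<Sum>\<sigma>\<in>Sh p (k - p). koszul ds (inv \<sigma>) * f (permute_list (inv \<sigma>) xs)) = 0"
      using sum_Sh_eq_shuffle_sum[of ds xs p f] zip p len by (simp add: ev_def[abs_def])
  qed
qed

text \<open>Linearity in the last argument reduces an arbitrary \<open>y\<close> to its homogeneous
  components, so that the last argument becomes a letter too.\<close>

lemma C_vsp_iff:
  "\<Omega> \<in> C_vsp n \<longleftrightarrow> \<Omega> \<in> C n \<and> (\<forall>u v y. u \<noteq> [] \<and> v \<noteq> [] \<and> set u \<subseteq> letters \<and> set v \<subseteq> letters \<and>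
     y \<in> letters \<and> Suc (length u + length v) = n \<longrightarrow> shuffle_sum (\<lambda>w. ev \<Omega> (w @ [y])) u v = 0)"
  (is "_ \<longleftrightarrow> _ \<and> ?vanish")
proof (cases "\<Omega> \<in> C n")
  case True
  then have lin: "slotwise_linear \<Omega>"
    by (auto simp: C_def intro: multilinear_slotwise_linear)
  have "\<Omega> \<in> C_vsp n \<longleftrightarrow> (\<forall>k y. n = k + 1 \<longrightarrow> (\<forall>u v. u \<noteq> [] \<and> v \<noteq> [] \<and> set u \<subseteq> letters \<and>
      set v \<subseteq> letters \<and> length u + length v = k \<longrightarrow> shuffle_sum (ev (\<lambda>xs. \<Omega> (xs @ [y]))) u v = 0))"
    using True by (simp add: C_vsp_def vanishes_on_shuffles_iff)
  also have "\<dots> \<longleftrightarrow> ?vanish"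
  proof
    assume *: "\<forall>k y. n = k + 1 \<longrightarrow> (\<forall>u v. u \<noteq> [] \<and> v \<noteq> [] \<and> set u \<subseteq> letters \<and>
      set v \<subseteq> letters \<and> length u + length v = k \<longrightarrow> shuffle_sum (ev (\<lambda>xs. \<Omega> (xs @ [y]))) u v = 0)"
    show ?vanish
    proof (intro allI impI, elim conjE)
      fix u v :: "(int \<times> 'v) list" and y :: "int \<times> 'v"
      assume "u \<noteq> []" "v \<noteq> []" "set u \<subseteq> letters" "set v \<subseteq> letters" "Suc (length u + length v) = n"
      then have "shuffle_sum (ev (\<lambda>xs. \<Omega> (xs @ [snd y]))) u v = 0"
        by (intro *[rule_format]) auto
      then show "shuffle_sum (\<lambda>w. ev \<Omega> (w @ [y])) u v = 0"
        by (simp add: ev_def[abs_def])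
    qed
  next
    assume *: ?vanish
    show "\<forall>k y. n = k + 1 \<longrightarrow> (\<forall>u v. u \<noteq> [] \<and> v \<noteq> [] \<and> set u \<subseteq> letters \<and>
      set v \<subseteq> letters \<and> length u + length v = k \<longrightarrow> shuffle_sum (ev (\<lambda>xs. \<Omega> (xs @ [y]))) u v = 0)"
    proof (intro allI impI, elim conjE)
      fix k and y :: 'v and u v :: "(int \<times> 'v) list"
      assume "n = k + 1" "u \<noteq> []" "v \<noteq> []" "set u \<subseteq> letters" "set v \<subseteq> letters" "length u + length v = k"
      then have "shuffle_sum (\<lambda>w. ev \<Omega> (w @ [(d, V1_part d y)])) u v = 0" for d
        using V1_part_letter by (intro *[rule_format]) auto
      moreover have "ev (\<lambda>xs. \<Omega> (xs @ [y])) w = (\<Sum>d | V1_part d y \<noteq> 0. ev \<Omega> (w @ [(d, V1_part d y)]))" for w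
        using slotwise_linear_expand[OF lin, of "map snd w" y "[]"] by (simp add: ev_def)
      then have "ev (\<lambda>xs. \<Omega> (xs @ [y])) = (\<lambda>w. \<Sum>d | V1_part d y \<noteq> 0. ev \<Omega> (w @ [(d, V1_part d y)]))"
        by (rule ext)
      ultimately show "shuffle_sum (ev (\<lambda>xs. \<Omega> (xs @ [y]))) u v = 0"
        by (simp add: shuffle_sum_sum)
    qed
  qed
  finally show ?thesis using True by simp
qed (simp add: C_vsp_def)

text \<open>On homogeneous words, \<open>c m\<close> is \<Omega> cut off to the words of one total
  degree. Rotating or shuffling a word keeps its total degree, so the cut-off inherits every
  condition.\<close>

lemma component_in_C_vsp:
  assumes \<Omega>: "\<Omega> \<in> C_vsp n"
    and c: "\<And>m. c m \<in> CV_gr m" "finite {m. c m \<noteq> 0}" "\<Omega> = (\<Sum>m | c m \<noteq> 0. c m)"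
  shows "c m \<in> C_vsp n"
proof -
  have C: "multilinear n \<Omega>" "cyclic \<Omega>"
    using \<Omega> by (simp_all add: C_vsp_def C_def)
  \<comment> \<open>The shift by 2 undoes the grading by \<open>deg - 2\<close>: \<open>c m\<close>
    lives on words of degree \<open>- m - 2\<close>.\<close>
  have ev_c: "ev (c m) w = (if m + 2 + wdeg w = 0 then ev \<Omega> w else 0)" if w: "set w \<subseteq> letters" for m w
  proof -
    have *: "ev (c j) w = 0" if "j + 2 + wdeg w \<noteq> 0" for j
      using c(1)[of j] has_degree_ev[OF _ w, of "c j" "j + 2"] that by (auto simp: CV_gr_def)
    have "ev \<Omega> w = (\<Sum>j | c j \<noteq> 0. ev (c j) w)"
      by (subst c(3)) (simp add: ev_def sum_fun_apply)
    also have "\<dots> = (\<Sum>j | c j \<noteq> 0. if j = - 2 - wdeg w then ev (c j) w else 0)"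
      by (rule sum.cong) (use * in auto)
    also have "\<dots> = ev (c (- 2 - wdeg w)) w"
      using c(2) by (auto simp: ev_def)
    finally have "ev \<Omega> w = ev (c (- 2 - wdeg w)) w" .
    then show ?thesis
    proof (cases "m + 2 + wdeg w = 0")
      case True
      then have "- 2 - wdeg w = m" by linarith
      then show ?thesis
        by (simp only: True \<open>ev \<Omega> w = ev (c (- 2 - wdeg w)) w\<close>) simp
    qed (simp add: *)
  qed
  have lin: "slotwise_linear (c m)"
    using c(1) by (auto simp: CV_gr_def intro: slotwise_linear_CV)
  have "c m xs = 0" if "length xs \<noteq> n" for xs
    using that C(1) by (intro slotwise_linear_eq_0[OF lin]) (simp add: ev_c, simp add: ev_def multilinear_def)
  then have "multilinear n (c m)"
    using lin by (simp add: multilinear_def slotwise_linear_def)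
  moreover have "cyclic (c m)"
    using C(2) unfolding cyclic_iff_ev by (auto simp: ev_c add_ac)
  moreover have "shuffle_sum (\<lambda>w. ev (c m) (w @ [y])) u v = 0"
    if "u \<noteq> []" "v \<noteq> []" and L: "set u \<subseteq> letters" "set v \<subseteq> letters" "y \<in> letters"
      and "Suc (length u + length v) = n" for u v y
  proof -
    have "shuffle_sum (\<lambda>w. ev (c m) (w @ [y])) u v =
        shuffle_sum (\<lambda>w. (if m + 2 + (wdeg u + wdeg v + fst y) = 0 then 1 else 0) * ev \<Omega> (w @ [y])) u v"
    proof (rule shuffle_sum_cong)
      fix w assume w: "mset w = mset u + mset v"
      then have "wdeg w = wdeg u + wdeg v" "set w = set u \<union> set v"
        using wdeg_mset_cong[of w "u @ v"] mset_eq_setD[of w "u @ v"] by simp_all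
      then show "ev (c m) (w @ [y]) =
          (if m + 2 + (wdeg u + wdeg v + fst y) = 0 then 1 else 0) * ev \<Omega> (w @ [y])"
        using L by (simp add: ev_c)
    qed
    also have "\<dots> = 0"
      using conjunct2[OF \<Omega>[unfolded C_vsp_iff], rule_format, of u v y] that
      by (simp add: shuffle_sum_mult_left)
    finally show ?thesis .
  qed
  ultimately show ?thesis
    unfolding C_vsp_iff C_def by blast
qed

text \<open>The bracket formula is available for a homogeneous second argument, and
  \<open>graded_space_span\<close> asks for homogeneous generators; this supplies both.\<close>

lemma CV_vsp_eq_span_homogeneous:
  assumes "graded_space fscale CV CV_gr"
  shows "CV_vsp = module.span fscale (\<Union>n m. C_vsp n \<inter> CV_gr m)"
proof -
  interpret F: module "fscale :: 'k \<Rightarrow> ('v, 'k) form \<Rightarrow> _" by (rule module_fscale)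
  let ?H = "\<Union>n m. C_vsp n \<inter> CV_gr m"
  have "C_vsp n \<subseteq> F.span ?H" for n
  proof
    fix \<Omega> assume \<Omega>: "\<Omega> \<in> C_vsp n"
    then have "\<Omega> \<in> CV"
      using C_subset_CV[of n] by (auto simp: C_vsp_def)
    then have "\<exists>!c. (\<forall>m. c m \<in> CV_gr m) \<and> finite {m. c m \<noteq> 0} \<and> \<Omega> = (\<Sum>m | c m \<noteq> 0. c m)"
      using assms by (simp add: graded_space_def)
    then obtain c where c: "(\<forall>m. c m \<in> CV_gr m) \<and> finite {m. c m \<noteq> 0} \<and> \<Omega> = (\<Sum>m | c m \<noteq> 0. c m)"
      by (rule ex1E)
    then have "c m \<in> C_vsp n \<inter> CV_gr m" for m
      using component_in_C_vsp[OF \<Omega>, of c m] by blast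
    then have "c m \<in> F.span ?H" for m
      by (intro F.span_base) blast
    then have "(\<Sum>m | c m \<noteq> 0. c m) \<in> F.span ?H"
      by (intro F.span_sum)
    then show "\<Omega> \<in> F.span ?H"
      using c by simp
  qed
  then have "F.span (\<Union>n. C_vsp n) \<subseteq> F.span ?H"
    by (intro F.span_minimal F.subspace_span) blast
  moreover have "F.span ?H \<subseteq> F.span (\<Union>n. C_vsp n)"
    by (intro F.span_mono) blast
  ultimately show ?thesis
    by (simp add: CV_vsp_def)
qed

section \<open>The bracket on words\<close>

lemma kills_zero_tensor:
  assumes "kills_zero A" "kills_zero B"
  shows "kills_zero (tensor A B)"
    and "set w \<subseteq> letters \<Longrightarrow> ev (tensor A B) w =
      cuts (\<lambda>p q. psign (wdeg p * wdeg q) * (ev A p * ev B q)) w"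
proof -
  let ?F = "\<lambda>ds xs. \<Sum>p\<le>length xs.
     (-1) powi (sum_list (take p ds) * sum_list (drop p ds)) * A (take p xs) * B (drop p xs)"
  have F: "?F ds ys = 0" if "0 \<in> set ys" for ds ys
  proof (intro sum.neutral ballI)
    fix p
    have "0 \<in> set (take p ys) \<or> 0 \<in> set (drop p ys)"
      using that by (metis Un_iff append_take_drop_id set_append)
    then show "(-1) powi (sum_list (take p ds) * sum_list (drop p ds)) * A (take p ys) * B (drop p ys) = 0"
      using assms by (auto simp: kills_zero_def)
  qed
  show "kills_zero (tensor A B)"
    unfolding kills_zero_def tensor_def by (intro allI impI extend_eq_0 F)
  assume "set w \<subseteq> letters"
  then have "tensor A B (map snd w) = ?F (map fst w) (map snd w)"
    unfolding tensor_def by (intro extend_homogeneous homogeneous_word F)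
  then show "ev (tensor A B) w = cuts (\<lambda>p q. psign (wdeg p * wdeg q) * (ev A p * ev B q)) w"
    by (simp add: cuts_def ev_def wdeg_def take_map drop_map powi_minus_one_eq_psign mult.assoc)
qed

lemma ev_Cycl:
  assumes "kills_zero T" "set w \<subseteq> letters" "w \<noteq> []"
  shows "ev (Cycl T) w =
    (\<Sum>r<length w. psign (wdeg (take r w) * wdeg (drop r w)) * ev T (drop r w @ take r w))"
proof -
  let ?F = "\<lambda>ds xs. \<Sum>\<tau> \<in> cyclic_perms (length xs). koszul ds \<tau> * T (permute_list \<tau> xs)"
  have "?F ds ys = 0" if "length ds = length ys" "0 \<in> set ys" for ds ys
  proof -
    have "T (drop r ys @ take r ys) = 0" for r
    proof -
      have "0 \<in> set (drop r ys @ take r ys)"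
        using that(2) by (metis Un_commute append_take_drop_id set_append)
      then show ?thesis
        using assms(1) by (simp add: kills_zero_def)
    qed
    moreover have "ys \<noteq> []"
      using that(2) by auto
    ultimately show ?thesis
      using that(1) by (simp add: sum_cyclic_perms)
  qed
  then have "Cycl T (map snd w) = ?F (map fst w) (map snd w)"
    unfolding Cycl_def using assms(2) by (intro extend_homogeneous homogeneous_word)
  also have "\<dots> = (\<Sum>r<length (map snd w). psign (sum_list (take r (map fst w)) * sum_list (drop r (map fst w))) *
      T (drop r (map snd w) @ take r (map snd w)))"
    using assms(3) by (intro sum_cyclic_perms) auto
  finally show ?thesis
    by (simp add: ev_def wdeg_def take_map drop_map)
qed

text \<open>The rotations of \<open>X @ [Y]\<close> are the words \<open>Q @ Y # P\<close> with \<open>X = P @ Q\<close>.\<close>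

lemma ev_odot_snoc:
  assumes "kills_zero A" "kills_zero B" "set X \<subseteq> letters" "Y \<in> letters"
  shows "ev (odot A B) (X @ [Y]) = cuts (\<lambda>P Q. psign (wdeg P * (wdeg Q + fst Y)) *
    cuts (\<lambda>p q. psign (wdeg p * wdeg q) * (ev A p * ev B q)) (Q @ Y # P)) X"
proof -
  \<comment> \<open>The rotation by \<open>r\<close> puts \<open>take r X\<close> behind
    \<open>Y\<close>; as \<open>Y\<close> is one additional letter, \<open>r\<close> runs up to
    \<open>length X\<close>, as in \<open>cuts\<close>.\<close>
  have "ev (odot A B) (X @ [Y]) = cuts (\<lambda>P Q. psign (wdeg P * (wdeg Q + fst Y)) *
      ev (tensor A B) (Q @ Y # P)) X"
    unfolding odot_def using assms
    by (subst ev_Cycl) (auto simp: kills_zero_tensor cuts_def lessThan_Suc_atMost intro!: sum.cong)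
  also have "\<dots> = cuts (\<lambda>P Q. psign (wdeg P * (wdeg Q + fst Y)) *
      cuts (\<lambda>p q. psign (wdeg p * wdeg q) * (ev A p * ev B q)) (Q @ Y # P)) X"
  proof (rule cuts_cong)
    fix P Q assume "P @ Q = X"
    then have "set (Q @ Y # P) \<subseteq> letters"
      using assms(3,4) by auto
    then show "psign (wdeg P * (wdeg Q + fst Y)) * ev (tensor A B) (Q @ Y # P) =
        psign (wdeg P * (wdeg Q + fst Y)) *
        cuts (\<lambda>p q. psign (wdeg p * wdeg q) * (ev A p * ev B q)) (Q @ Y # P)"
      by (simp only: kills_zero_tensor(2)[OF assms(1,2)])
  qed
  finally show ?thesis .
qed

lemma ev_iota: "ev (\<iota> (snd c) \<Omega>) w = ev \<Omega> (c # w)"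
  by (simp add: ev_def \<iota>_def)

text \<open>Both prefactors depend on \<open>X\<close> at most through its total degree, so they are
  constant on the words of a shuffle. Where a term is nonzero, the degrees of the forms tie the
  parities of \<open>a\<close> and \<open>n\<close> to those of the letters, and the signs are
  compared by cases on parities.\<close>

lemma ev_odot_iota:
  assumes A: "kills_zero A" "cyclic A" "has_degree A a"
    and B: "kills_zero B" "cyclic B" "has_degree B n"
    and c: "c \<in> letters" "c' \<in> letters" "even (fst c + fst c')"
    and X: "set X \<subseteq> letters" "Y \<in> letters"
  shows "psign (n * fst c) * ev (odot (\<iota> (snd c) A) (\<iota> (snd c') B)) (X @ [Y]) =
    psign (fst c + a * fst Y) *
      cuts (\<lambda>w1. cuts (\<lambda>w2 w3. psign (a * wdeg w3) * ev A (c # w2) * ev B ((w1 @ c' # w3) @ [Y]))) X +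
    psign (n * (wdeg X + 1)) *
      cuts (\<lambda>w1. cuts (\<lambda>w2 w3. psign (n * wdeg w3) * ev B (c' # w2) * ev A ((w1 @ c # w3) @ [Y]))) X"
proof -
  have kz: "kills_zero (\<iota> (snd c) A)" "kills_zero (\<iota> (snd c') B)"
    using A(1) B(1) by (auto simp: kills_zero_def \<iota>_def)
  let ?T = "\<lambda>p q. psign (wdeg p * wdeg q) * (ev A (c # p) * ev B (c' # q))"
  \<comment> \<open>The first sum has \<open>Y\<close> in the argument of \<open>B\<close>, the
    second in that of \<open>A\<close>.\<close>
  have "psign (n * fst c) * ev (odot (\<iota> (snd c) A) (\<iota> (snd c') B)) (X @ [Y]) =
      cuts (\<lambda>P Q. cuts (\<lambda>w2 w3. psign (n * fst c) * (psign (wdeg P * (wdeg Q + fst Y)) * ?T w2 (w3 @ Y # P))) Q) X +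
      cuts (\<lambda>P Q. cuts (\<lambda>w1 w2. psign (n * fst c) * (psign (wdeg P * (wdeg Q + fst Y)) * ?T (Q @ Y # w1) w2)) P) X"
    unfolding ev_odot_snoc[OF kz X] ev_iota cuts_append_Cons distrib_left cuts_add cuts_mult_left ..
  also have "cuts (\<lambda>P Q. cuts (\<lambda>w2 w3. psign (n * fst c) * (psign (wdeg P * (wdeg Q + fst Y)) * ?T w2 (w3 @ Y # P))) Q) X =
      psign (fst c + a * fst Y) *
      cuts (\<lambda>w1. cuts (\<lambda>w2 w3. psign (a * wdeg w3) * ev A (c # w2) * ev B ((w1 @ c' # w3) @ [Y]))) X"
    unfolding cuts_mult_left[symmetric]
  proof (intro cuts_cong)
    fix P Q w2 w3 assume "P @ Q = X" "w2 @ w3 = Q"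
    then have L: "set P \<subseteq> letters" "set w2 \<subseteq> letters" "set w3 \<subseteq> letters" and Q: "wdeg Q = wdeg w2 + wdeg w3"
      using X(1) by auto
    \<comment> \<open>Cyclicity of \<open>B\<close> brings \<open>P\<close> to the front and
      \<open>Y\<close> to the end, so that \<open>c'\<close> stands in the place of the missing
      \<open>w2\<close>.\<close>
    have rot: "ev B (c' # w3 @ Y # P) =
        psign ((fst c' + wdeg w3 + fst Y) * wdeg P) * ev B ((P @ c' # w3) @ [Y])"
      using cyclic_rotate[OF B(2), of "c' # w3 @ [Y]" P] L c X(2) by (simp add: add.assoc)
    show "psign (n * fst c) * (psign (wdeg P * (wdeg Q + fst Y)) * ?T w2 (w3 @ Y # P)) =
        psign (fst c + a * fst Y) * (psign (a * wdeg w3) * ev A (c # w2) * ev B ((P @ c' # w3) @ [Y]))"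
    proof (cases "ev A (c # w2) = 0 \<or> ev B ((P @ c' # w3) @ [Y]) = 0")
      case True
      then show ?thesis by (auto simp: rot)
    next
      case False
      have "a + (fst c + wdeg w2) = 0"
        using has_degree_ev[OF A(3), of "c # w2"] False L c by simp
      moreover have "n + (wdeg P + fst c' + wdeg w3 + fst Y) = 0"
        using has_degree_ev[OF B(3), of "(P @ c' # w3) @ [Y]"] False L c X(2) by (simp add: add.assoc)
      ultimately have "even a \<longleftrightarrow> even (fst c + wdeg w2)"
        "even n \<longleftrightarrow> even (wdeg P + fst c + wdeg w3 + fst Y)"
        using c(3) by presburger+
      then have "even (n * fst c + wdeg P * (wdeg Q + fst Y) + wdeg w2 * wdeg (w3 @ Y # P) +
          (fst c' + wdeg w3 + fst Y) * wdeg P + (fst c + a * fst Y) + a * wdeg w3)"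
        using c(3) unfolding Q wdeg_simps even_add even_mult_iff
        by (cases "even (fst c)"; cases "even (wdeg P)"; cases "even (wdeg w2)"; cases "even (wdeg w3)";
            cases "even (fst Y)"; simp)
      then show ?thesis
        unfolding rot by (rule psign_regroup)
    qed
  qed
  \<comment> \<open>Expressing \<open>wdeg P\<close> through its pieces removes \<open>P\<close>
    from the summand, as \<open>cuts_coassoc\<close> requires.\<close>
  also have "cuts (\<lambda>P Q. cuts (\<lambda>w1 w2. psign (n * fst c) * (psign (wdeg P * (wdeg Q + fst Y)) * ?T (Q @ Y # w1) w2)) P) X =
      cuts (\<lambda>P Q. cuts (\<lambda>w1 w2. psign (n * fst c) * (psign ((wdeg w1 + wdeg w2) * (wdeg Q + fst Y)) *
        ?T (Q @ Y # w1) w2)) P) X"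
    by (intro cuts_cong) auto
  also have "\<dots> = psign (n * (wdeg X + 1)) *
      cuts (\<lambda>w1. cuts (\<lambda>w2 w3. psign (n * wdeg w3) * ev B (c' # w2) * ev A ((w1 @ c # w3) @ [Y]))) X"
    unfolding cuts_mult_left[symmetric]
  proof (subst cuts_coassoc, intro cuts_cong)
    fix w1 Q w2 w3 assume "w1 @ Q = X" "w2 @ w3 = Q"
    then have L: "set w1 \<subseteq> letters" "set w2 \<subseteq> letters" "set w3 \<subseteq> letters"
      and wX: "wdeg X = wdeg w1 + wdeg w2 + wdeg w3"
      using X(1) by auto
    have rot: "ev A (c # w3 @ Y # w1) =
        psign ((fst c + wdeg w3 + fst Y) * wdeg w1) * ev A ((w1 @ c # w3) @ [Y])"
      using cyclic_rotate[OF A(2), of "c # w3 @ [Y]" w1] L c X(2) by (simp add: add.assoc)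
    show "psign (n * fst c) * (psign ((wdeg w1 + wdeg w2) * (wdeg w3 + fst Y)) * ?T (w3 @ Y # w1) w2) =
        psign (n * (wdeg X + 1)) * (psign (n * wdeg w3) * ev B (c' # w2) * ev A ((w1 @ c # w3) @ [Y]))"
    proof (cases "ev B (c' # w2) = 0")
      case False
      then have "n + (fst c' + wdeg w2) = 0"
        using has_degree_ev[OF B(3), of "c' # w2"] L c by simp
      then have "even n \<longleftrightarrow> even (fst c + wdeg w2)"
        using c(3) by presburger
      then have "even (n * fst c + (wdeg w1 + wdeg w2) * (wdeg w3 + fst Y) + wdeg (w3 @ Y # w1) * wdeg w2 +
          (fst c + wdeg w3 + fst Y) * wdeg w1 + n * (wdeg X + 1) + n * wdeg w3)"
        unfolding wX wdeg_simps even_add even_mult_iff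
        by (cases "even (fst c)"; cases "even (wdeg w1)"; cases "even (wdeg w2)"; cases "even (wdeg w3)";
            cases "even (fst Y)"; simp)
      then show ?thesis
        unfolding rot mult.commute[of "psign ((fst c + wdeg w3 + fst Y) * wdeg w1) * ev A ((w1 @ c # w3) @ [Y])"]
        by (rule psign_regroup)
    qed simp
  qed
  finally show ?thesis .
qed

section \<open>Vanishing on shuffles for brackets of homogeneous forms\<close>

lemma shuffle_sum_C_vsp_snoc:
  assumes "\<Omega> \<in> C_vsp n" "c \<in> letters" "p \<noteq> []" "q \<noteq> []" "set p \<subseteq> letters" "set q \<subseteq> letters"
  shows "shuffle_sum (\<lambda>w. ev \<Omega> (w @ [c])) p q = 0"
proof (cases "Suc (length p + length q) = n")
  case True
  then show ?thesis
    using conjunct2[OF assms(1)[unfolded C_vsp_iff], rule_format, of p q c] assms by blast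
next
  case False
  \<comment> \<open>In any other arity every single value is zero already.\<close>
  have "shuffle_sum (\<lambda>w. ev \<Omega> (w @ [c])) p q = shuffle_sum (\<lambda>w. 0) p q"
  proof (rule shuffle_sum_cong)
    fix w assume "mset w = mset p + mset q"
    then have "length w = length p + length q"
      by (metis size_mset size_union)
    then show "ev \<Omega> (w @ [c]) = 0"
      using assms(1) False by (simp add: ev_def C_vsp_def C_def multilinear_def)
  qed
  then show ?thesis by simp
qed

text \<open>Cyclicity moves \<open>c\<close> to the end at the cost of a sign that is the same for
  all words of the shuffle.\<close>

lemma shuffle_sum_C_vsp_Cons:
  assumes "\<Omega> \<in> C_vsp n" "c \<in> letters" "p \<noteq> []" "q \<noteq> []" "set p \<subseteq> letters" "set q \<subseteq> letters"
  shows "shuffle_sum (\<lambda>w. ev \<Omega> (c # w)) p q = 0"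
proof -
  have "shuffle_sum (\<lambda>w. ev \<Omega> (c # w)) p q =
      shuffle_sum (\<lambda>w. psign (fst c * (wdeg p + wdeg q)) * ev \<Omega> (w @ [c])) p q"
  proof (rule shuffle_sum_cong)
    fix w assume w: "mset w = mset p + mset q"
    then have "wdeg w = wdeg p + wdeg q" "set w \<subseteq> letters"
      using assms(5,6) wdeg_mset_cong[of w "p @ q"] mset_eq_setD[of w "p @ q"] by simp_all
    moreover have "cyclic \<Omega>"
      using assms(1) by (simp add: C_vsp_def C_def)
    ultimately show "ev \<Omega> (c # w) = psign (fst c * (wdeg p + wdeg q)) * ev \<Omega> (w @ [c])"
      using assms(2) cyclic_rotate[of \<Omega> "[c]" w] by simp
  qed
  also have "\<dots> = 0"
    by (simp add: shuffle_sum_mult_left shuffle_sum_C_vsp_snoc[OF assms])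
  finally show ?thesis .
qed

text \<open>As \<open>b\<close> has degree 0, paired vectors have opposite degrees in V. After the
  shift the two degrees add up to -2, so they have the same parity.\<close>

lemma dual_bases_letters:
  assumes b: "inner_form b" and dual: "dual_bases b N d e e'" and "i < N"
  obtains d' where "(d i, e i) \<in> letters" "(d', e' i) \<in> letters" "even (d i + d')"
proof -
  obtain d' where hb: "homogeneous_basis N d e" "homogeneous_basis N d' e'" and "b (e i) (e' i) = 1"
    using dual \<open>i < N\<close> by (auto simp: dual_bases_def)
  then have V: "e i \<in> V1 (d i)" "e' i \<in> V1 (d' i)"
    using \<open>i < N\<close> by (simp_all add: homogeneous_basis_def)
  have "(d i + 1) + (d' i + 1) = 0"
  proof (rule ccontr)
    assume "(d i + 1) + (d' i + 1) \<noteq> 0"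
    then have "b (e i) (e' i) = 0"
      using b V unfolding inner_form_def V1_def by blast
    then show False
      using \<open>b (e i) (e' i) = 1\<close> by simp
  qed
  then have "even (d i + d' i)" by presburger
  with V show thesis
    by (intro that[of "d' i"]) (simp_all add: letters_def)
qed

text \<open>The two sums in \<open>ev_odot_iota\<close> are insertions with the roles of
  \<open>A\<close> and \<open>B\<close> exchanged. The equal parity of \<open>c\<close> and
  \<open>c'\<close> turns homogeneity of the inserted form into the \<open>parity\<close> hypothesis
  of \<open>shuffle_sum_insertion\<close>.\<close>

lemma shuffle_sum_odot_iota:
  assumes A: "A \<in> C_vsp k" "has_degree A a" and B: "B \<in> C_vsp l" "has_degree B n"
    and c: "c \<in> letters" "c' \<in> letters" "even (fst c + fst c')"
    and u: "u \<noteq> []" "set u \<subseteq> letters" and v: "v \<noteq> []" "set v \<subseteq> letters" and Y: "Y \<in> letters"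
  shows "shuffle_sum (\<lambda>w. psign (n * fst c) * ev (odot (\<iota> (snd c) A) (\<iota> (snd c') B)) (w @ [Y])) u v = 0"
proof -
  have AC: "kills_zero A" "cyclic A" and BC: "kills_zero B" "cyclic B"
    using A(1) B(1) by (auto simp: C_vsp_def C_def intro: slotwise_linear_kills_zero multilinear_slotwise_linear)
  have "shuffle_sum (\<lambda>w. psign (n * fst c) * ev (odot (\<iota> (snd c) A) (\<iota> (snd c') B)) (w @ [Y])) u v =
    shuffle_sum (\<lambda>w. psign (fst c + a * fst Y) *
      cuts (\<lambda>w1. cuts (\<lambda>w2 w3. psign (a * wdeg w3) * ev A (c # w2) * ev B ((w1 @ c' # w3) @ [Y]))) w +
    psign (n * (wdeg u + wdeg v + 1)) *
      cuts (\<lambda>w1. cuts (\<lambda>w2 w3. psign (n * wdeg w3) * ev B (c' # w2) * ev A ((w1 @ c # w3) @ [Y]))) w) u v"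
  proof (rule shuffle_sum_cong)
    fix w assume w: "mset w = mset u + mset v"
    then have deg: "wdeg w = wdeg u + wdeg v" and L: "set w \<subseteq> letters"
      using u v wdeg_mset_cong[of w "u @ v"] mset_eq_setD[of w "u @ v"] by simp_all
    show "psign (n * fst c) * ev (odot (\<iota> (snd c) A) (\<iota> (snd c') B)) (w @ [Y]) =
      psign (fst c + a * fst Y) *
        cuts (\<lambda>w1. cuts (\<lambda>w2 w3. psign (a * wdeg w3) * ev A (c # w2) * ev B ((w1 @ c' # w3) @ [Y]))) w +
      psign (n * (wdeg u + wdeg v + 1)) *
        cuts (\<lambda>w1. cuts (\<lambda>w2 w3. psign (n * wdeg w3) * ev B (c' # w2) * ev A ((w1 @ c # w3) @ [Y]))) w"
      unfolding deg[symmetric] by (rule ev_odot_iota[OF AC A(2) BC B(2) c L Y])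
  qed
  also have "\<dots> = 0"
  proof -
    have "shuffle_sum (cuts (\<lambda>w1. cuts (\<lambda>w2 w3.
        psign (a * wdeg w3) * ev A (c # w2) * ev B ((w1 @ c' # w3) @ [Y])))) u v = 0"
    proof (rule shuffle_sum_insertion[OF u v c(2), where F = "\<lambda>w. ev B (w @ [Y])"])
      fix p :: "(int \<times> 'v) list"
      assume "set p \<subseteq> letters" "ev A (c # p) \<noteq> 0"
      then have "a + (fst c + wdeg p) = 0"
        using has_degree_ev[OF A(2), of "c # p"] c(1) by simp
      then show "even (a + wdeg p + fst c')"
        using c(3) by presburger
    qed (use shuffle_sum_C_vsp_snoc[OF B(1) Y] shuffle_sum_C_vsp_Cons[OF A(1) c(1)] in blast)+
    moreover have "shuffle_sum (cuts (\<lambda>w1. cuts (\<lambda>w2 w3.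
        psign (n * wdeg w3) * ev B (c' # w2) * ev A ((w1 @ c # w3) @ [Y])))) u v = 0"
    proof (rule shuffle_sum_insertion[OF u v c(1), where F = "\<lambda>w. ev A (w @ [Y])"])
      fix p :: "(int \<times> 'v) list"
      assume "set p \<subseteq> letters" "ev B (c' # p) \<noteq> 0"
      then have "n + (fst c' + wdeg p) = 0"
        using has_degree_ev[OF B(2), of "c' # p"] c(2) by simp
      then show "even (n + wdeg p + fst c)"
        using c(3) by presburger
    qed (use shuffle_sum_C_vsp_snoc[OF A(1) Y] shuffle_sum_C_vsp_Cons[OF B(1) c(2)] in blast)+
    ultimately show ?thesis
      by (simp only: shuffle_sum_add shuffle_sum_mult_left) simp
  qed
  finally show ?thesis .
qed

lemma bracket_in_CV_vsp:
  assumes br: "pinczon_bracket br"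
    and A: "A \<in> C_vsp k" "A \<in> CV_gr a" and B: "B \<in> C_vsp l" "B \<in> CV_gr n"
  shows "br A B \<in> CV_vsp"
proof -
  interpret F: module "fscale :: 'k \<Rightarrow> ('v, 'k) form \<Rightarrow> _" by (rule module_fscale)
  have CV: "A \<in> CV" "B \<in> CV" and deg: "has_degree A (a + 2)" "has_degree B (n + 2)"
    using A(2) B(2) by (auto simp: CV_gr_def)
  have lie: "graded_lie_algebra fscale CV CV_gr br" and centre: "C 0 \<subseteq> centre br"
    and arity: "\<And>i j A B. A \<in> C (i + 1) \<Longrightarrow> B \<in> C (j + 1) \<Longrightarrow> br A B \<in> C (i + j)"
    using br by (auto simp: pinczon_bracket_def)
  obtain b where b: "inner_form b" "bracket_of b br"
    using br by (auto simp: pinczon_bracket_def)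
  \<comment> \<open>The arity clause speaks of positive arities, so constants are handled through
    the centre. For constant \<open>B\<close>, graded antisymmetry first swaps the
    arguments.\<close>
  have zero: "br A B = 0" if "k = 0 \<or> l = 0"
    using that
  proof
    assume "k = 0"
    then have "A \<in> centre br"
      using A(1) centre by (auto simp: C_vsp_def)
    then show ?thesis using CV(2) by (simp add: centre_def)
  next
    assume "l = 0"
    then have "B \<in> centre br"
      using B(1) centre by (auto simp: C_vsp_def)
    then have "br B A = 0" using CV(1) by (simp add: centre_def)
    moreover have "br A B = - fscale ((-1) powi (a * n)) (br B A)"
      using lie A(2) B(2) unfolding graded_lie_algebra_def by blast
    ultimately show ?thesis by simp
  qed
  show ?thesis
  proof (cases "k = 0 \<or> l = 0")
    case True
    then show ?thesis
      using zero F.span_zero by (simp add: CV_vsp_def)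
  next
    case False
    then obtain i j where ij: "k = i + 1" "l = j + 1"
      by (metis Suc_eq_plus1 not0_implies_Suc)
    obtain N d e e' where dual: "dual_bases b N d e e'"
      and formula: "\<And>\<Omega> m \<Omega>'. \<Omega> \<in> CV \<Longrightarrow> \<Omega>' \<in> CV \<Longrightarrow> has_degree \<Omega>' m \<Longrightarrow>
        br \<Omega> \<Omega>' = (\<Sum>i<N. fscale ((-1) powi (m * d i)) (odot (\<iota> (e i) \<Omega>) (\<iota> (e' i) \<Omega>')))"
      using b(2) unfolding bracket_of_def by blast
    have "br A B \<in> C_vsp (i + j)"
      unfolding C_vsp_iff
    proof (intro conjI allI impI, goal_cases)
      case 1
      show ?case
        using A(1) B(1) ij by (intro arity) (auto simp: C_vsp_def)
    next
      case (2 u v y)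
      then have uv: "u \<noteq> []" "set u \<subseteq> letters" "v \<noteq> []" "set v \<subseteq> letters" "y \<in> letters"
        by blast+
      have "ev (br A B) w = (\<Sum>i<N. psign ((n + 2) * d i) * ev (odot (\<iota> (e i) A) (\<iota> (e' i) B)) w)" for w
        by (simp add: formula[OF CV deg(2)] ev_def sum_fun_apply fscale_def powi_minus_one_eq_psign)
      then have "shuffle_sum (\<lambda>w. ev (br A B) (w @ [y])) u v =
          (\<Sum>i<N. shuffle_sum (\<lambda>w. psign ((n + 2) * d i) * ev (odot (\<iota> (e i) A) (\<iota> (e' i) B)) (w @ [y])) u v)"
        by (simp only: shuffle_sum_sum)
      also have "\<dots> = 0"
      proof (intro sum.neutral ballI)
        fix i assume "i \<in> {..<N}"
        then obtain d' where "(d i, e i) \<in> letters" "(d', e' i) \<in> letters" "even (d i + d')"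
          using dual_bases_letters[OF b(1) dual, of i] by blast
        then show "shuffle_sum (\<lambda>w. psign ((n + 2) * d i) *
            ev (odot (\<iota> (e i) A) (\<iota> (e' i) B)) (w @ [y])) u v = 0"
          using shuffle_sum_odot_iota[OF A(1) deg(1) B(1) deg(2), of "(d i, e i)" "(d', e' i)" u v y] uv
          by simp
      qed
      finally show ?case .
    qed
    then show ?thesis
      unfolding CV_vsp_def by (intro F.span_base) blast
  qed
qed

text \<open>Bilinearity extends \<open>bracket_in_CV_vsp\<close> from homogeneous generators, first
  in the left argument and then in the right. The sets in question are cut down to
  \<open>CV\<close>, where \<open>br\<close> is known to be bilinear.\<close>

lemma graded_lie_subalgebra_CV_vsp:
  assumes br: "pinczon_bracket br"
  shows "graded_lie_subalgebra fscale CV CV_gr br CV_vsp"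
proof -
  interpret F: module "fscale :: 'k \<Rightarrow> ('v, 'k) form \<Rightarrow> _" by (rule module_fscale)
  let ?H = "\<Union>k m. C_vsp k \<inter> CV_gr m"
  have lie: "graded_lie_algebra fscale CV CV_gr br"
    using br by (simp add: pinczon_bracket_def)
  then have gs: "graded_space fscale CV CV_gr"
    by (simp add: graded_lie_algebra_def)
  note span = CV_vsp_eq_span_homogeneous[OF gs]
  have sub: "CV_vsp \<subseteq> CV" and graded_vsp: "graded_space fscale CV_vsp (\<lambda>n. CV_vsp \<inter> CV_gr n)"
    unfolding span by (rule graded_space_span[OF module_fscale gs]; blast)+
  have add: "br (x + y) z = br x z + br y z" "br x (y + z) = br x y + br x z"
    if "x \<in> CV" "y \<in> CV" "z \<in> CV" for x y z
    using lie that by (auto simp: graded_lie_algebra_def)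
  have scale: "br (fscale c x) y = fscale c (br x y)" "br x (fscale c y) = fscale c (br x y)"
    if "x \<in> CV" "y \<in> CV" for c x y
    using lie that by (auto simp: graded_lie_algebra_def)
  have CV_sub: "F.subspace CV" and vsp_sub: "F.subspace CV_vsp"
    by (simp_all add: CV_def CV_vsp_def)
  have zero: "br 0 y = 0" "br y 0 = 0" if "y \<in> CV" for y
    using scale[of 0 y 0] scale[of y 0 0] that F.subspace_0[OF CV_sub] by simp_all
  have H_CV: "x \<in> CV" if "x \<in> ?H" for x
    using that by (auto simp: CV_gr_def)
  have left: "br x y \<in> CV_vsp" if "x \<in> CV_vsp" "y \<in> ?H" for x y
  proof -
    have "F.span ?H \<subseteq> {x \<in> CV. br x y \<in> CV_vsp}"
    proof (rule F.span_minimal)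
      show "?H \<subseteq> {x \<in> CV. br x y \<in> CV_vsp}"
        using that(2) bracket_in_CV_vsp[OF br] H_CV by blast
      show "F.subspace {x \<in> CV. br x y \<in> CV_vsp}"
        using H_CV[OF that(2)] CV_sub vsp_sub
        by (intro F.subspaceI) (auto simp: zero add scale F.subspace_0 F.subspace_add F.subspace_scale)
    qed
    then show ?thesis using that(1) unfolding span by blast
  qed
  have "br x y \<in> CV_vsp" if "x \<in> CV_vsp" "y \<in> CV_vsp" for x y
  proof -
    have "F.span ?H \<subseteq> {y \<in> CV. br x y \<in> CV_vsp}"
    proof (rule F.span_minimal)
      show "?H \<subseteq> {y \<in> CV. br x y \<in> CV_vsp}"
        using left[OF that(1)] H_CV by blast
      show "F.subspace {y \<in> CV. br x y \<in> CV_vsp}"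
        using that(1) sub CV_sub vsp_sub
        by (intro F.subspaceI) (auto simp: subset_iff zero add scale F.subspace_0 F.subspace_add F.subspace_scale)
    qed
    then show ?thesis using that(2) unfolding span by blast
  qed
  then show ?thesis
    using sub graded_vsp by (simp add: graded_lie_subalgebra_def)
qed

end

theorem proposition5p3:
  fixes scale :: "'k::field_char_0 \<Rightarrow> 'v::ab_group_add \<Rightarrow> 'v"
    and gr :: "int \<Rightarrow> 'v set"
    and br :: "('v, 'k) form \<Rightarrow> ('v, 'k) form \<Rightarrow> ('v, 'k) form"
  assumes "fd_graded_vector_space scale gr"
    and "fd_graded_vector_space.pinczon_bracket scale gr br"
  shows "graded_lie_subalgebra fscale
           (fd_graded_vector_space.CV scale gr) (fd_graded_vector_space.CV_gr scale gr) br
           (fd_graded_vector_space.CV_vsp scale gr)"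
  using assms by (rule fd_graded_vector_space.graded_lie_subalgebra_CV_vsp)

end
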